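(* Let $g:Y\to Z$, $g(\boldsymbol u)=(\varphi(0)-\varphi_0,\,-\dot\varphi)$ for $\boldsymbol u=(u,\varphi)\in Y$, and let $M=\{\boldsymbol u\in Y: g(\boldsymbol u)\in K\}$. For every $\bar{\boldsymbol u}\in M$ the derivative $g'(\bar{\boldsymbol u}):Y\to Z$, given by $g'(\bar{\boldsymbol u})(\Phi_u,\Phi_\varphi)=(\Phi_\varphi(0),-\dot\Phi_\varphi)$, is surjective.
   Context: $\Omega\subset\mathbb{R}^2$ is a bounded Lipschitz domain with boundary partitioned as $\partial\Omega=\Gamma_N\cup\Gamma_D\cup\Gamma_F$, where $\Gamma_D,\Gamma_N$ have nonzero one-dimensional Hausdorff measure and $\Omega\cup\Gamma_N$ is regular in the sense of Gröger. $I=[0,T]$ with $T>0$. $V_\varphi=H^2(\Omega)$, $V_u=\{v\in H^1(\Omega;\mathbb{R}^2):v|_{\Gamma_D}=0\}$, $Y_u=L^2(I,V_u)$, $Y_\varphi=H^1(I,V_\varphi)$ (embedded in $C(I,V_\varphi)$), $Y=Y_u\times Y_\varphi$, $Z=V_\varphi\times L^2(I,V_\varphi)$, and $K=\{0\}\times K_2\subset Z$ with $K_2=\{z_2\in L^2(I,V_\varphi): z_2(t)\ge0\text{ a.e. in }\Omega\text{ for a.e. }t\in I\}$. Dots denote weak time derivatives, and $\varphi_0\in V_\varphi$ is given. *)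

theory Defs
  imports "HOL-Analysis.Analysis"
begin

section \<open>The Lebesgue--Bochner space of square integrable functions as a Banach space\<close>

definition square_integrable ::
    "('a::euclidean_space \<Rightarrow> 'b::{banach, second_countable_topology}) \<Rightarrow> bool" where
  "square_integrable f \<longleftrightarrow>
     f \<in> borel_measurable lborel \<and> integrable lborel (\<lambda>x. (norm (f x))\<^sup>2)"

lemma square_integrable_measurable [measurable_dest]:
  "square_integrable f \<Longrightarrow> f \<in> borel_measurable lborel"
  by (simp add: square_integrable_def)

lemma square_integrable_zero [simp]: "square_integrable (\<lambda>x. 0)"
  by (simp add: square_integrable_def)

lemma square_integrable_scaleR:
  "square_integrable f \<Longrightarrow> square_integrable (\<lambda>x. c *\<^sub>R f x)"
  by (auto simp: square_integrable_def power_mult_distrib)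

lemma norm_add_sq_le: "(norm (a + b))\<^sup>2 \<le> 2 * (norm a)\<^sup>2 + 2 * (norm b)\<^sup>2"
proof -
  have "(norm (a + b))\<^sup>2 \<le> (norm a + norm b)\<^sup>2"
    by (intro power_mono norm_triangle_ineq) auto
  also have "\<dots> \<le> 2 * (norm a)\<^sup>2 + 2 * (norm b)\<^sup>2"
    using sum_squares_bound[of "norm a" "norm b"] by (simp add: power2_sum)
  finally show ?thesis .
qed

lemma square_integrable_dominated:
  assumes "f \<in> borel_measurable lborel" "integrable lborel h"
    "\<And>x. (norm (f x))\<^sup>2 \<le> h x"
  shows "square_integrable f"
  unfolding square_integrable_def
proof
  show "integrable lborel (\<lambda>x. (norm (f x))\<^sup>2)"
  proof (rule Bochner_Integration.integrable_bound[OF assms(2)])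
    show "AE x in lborel. norm ((norm (f x))\<^sup>2) \<le> norm (h x)"
      using order_trans[OF assms(3) abs_ge_self] by simp
  qed (use assms(1) in measurable)
qed (fact assms(1))

lemma square_integrable_add:
  assumes "square_integrable f" "square_integrable g"
  shows "square_integrable (\<lambda>x. f x + g x)"
proof (rule square_integrable_dominated)
  show "integrable lborel (\<lambda>x. 2 * (norm (f x))\<^sup>2 + 2 * (norm (g x))\<^sup>2)"
    using assms by (simp add: square_integrable_def)
qed (use assms norm_add_sq_le in \<open>auto simp: square_integrable_def\<close>)

lemma square_integrable_minus:
  "square_integrable f \<Longrightarrow> square_integrable (\<lambda>x. - f x)"
  using square_integrable_scaleR[of f "-1"] by simp

lemma square_integrable_diff:
  "square_integrable f \<Longrightarrow> square_integrable g \<Longrightarrow> square_integrable (\<lambda>x. f x - g x)"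
  using square_integrable_add[of f "\<lambda>x. - g x"] square_integrable_minus[of g] by simp

text \<open>
  Equality in \<open>L2\<close> is equality almost everywhere. Borel representatives lose nothing, since every
  Lebesgue measurable function agrees almost everywhere with a Borel one. All functions live on the
  whole space; functions on a subset are extended by zero (see \<open>L2_on\<close> below).
\<close>

definition l2_equal ::
    "('a::euclidean_space \<Rightarrow> 'b::{banach, second_countable_topology}) \<Rightarrow> ('a \<Rightarrow> 'b) \<Rightarrow> bool" where
  "l2_equal f g \<longleftrightarrow>
     square_integrable f \<and> square_integrable g \<and> (AE x in lborel. f x = g x)"

lemma l2_equal_part_equivp:
  "part_equivp (l2_equal :: ('a::euclidean_space \<Rightarrow> 'b::{banach, second_countable_topology}) \<Rightarrow> _)"
proof (rule part_equivpI)
  show "\<exists>f :: 'a \<Rightarrow> 'b. l2_equal f f"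
    by (rule exI[of _ "\<lambda>x. 0"]) (simp add: l2_equal_def)
  show "symp (l2_equal :: ('a \<Rightarrow> 'b) \<Rightarrow> _)"
    by (auto simp: symp_def l2_equal_def eq_commute)
  show "transp (l2_equal :: ('a \<Rightarrow> 'b) \<Rightarrow> _)"
  proof (rule transpI)
    fix f g h :: "'a \<Rightarrow> 'b" assume fgh: "l2_equal f g" "l2_equal g h"
    then have "AE x in lborel. f x = g x" "AE x in lborel. g x = h x"
      by (auto simp: l2_equal_def)
    then have "AE x in lborel. f x = h x" by eventually_elim simp
    with fgh show "l2_equal f h" by (auto simp: l2_equal_def)
  qed
qed

quotient_type (overloaded) ('a, 'b) L2 =
  "'a::euclidean_space \<Rightarrow> 'b::{banach, second_countable_topology}" / partial: l2_equal
  by (rule l2_equal_part_equivp)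

instantiation L2 :: (euclidean_space, "{banach, second_countable_topology}") real_vector
begin

lift_definition zero_L2 :: "('a, 'b) L2" is "\<lambda>x. 0"
  by (simp add: l2_equal_def)

lift_definition plus_L2 :: "('a, 'b) L2 \<Rightarrow> ('a, 'b) L2 \<Rightarrow> ('a, 'b) L2" is "\<lambda>f g x. f x + g x"
  by (auto simp: l2_equal_def square_integrable_add)

lift_definition minus_L2 :: "('a, 'b) L2 \<Rightarrow> ('a, 'b) L2 \<Rightarrow> ('a, 'b) L2" is "\<lambda>f g x. f x - g x"
  by (auto simp: l2_equal_def square_integrable_diff)

lift_definition uminus_L2 :: "('a, 'b) L2 \<Rightarrow> ('a, 'b) L2" is "\<lambda>f x. - f x"
  by (auto simp: l2_equal_def square_integrable_minus)

lift_definition scaleR_L2 :: "real \<Rightarrow> ('a, 'b) L2 \<Rightarrow> ('a, 'b) L2" is "\<lambda>c f x. c *\<^sub>R f x"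
  by (auto simp: l2_equal_def square_integrable_scaleR)

instance
  by standard
    (transfer, auto simp: l2_equal_def algebra_simps intro!: square_integrable_scaleR
      square_integrable_add square_integrable_diff square_integrable_minus)+

end

definition l2_norm ::
    "('a::euclidean_space \<Rightarrow> 'b::{banach, second_countable_topology}) \<Rightarrow> real" where
  "l2_norm f = sqrt (LINT x|lborel. (norm (f x))\<^sup>2)"

lemma l2_norm_triangle:
  assumes f: "square_integrable f" and g: "square_integrable g"
  shows "l2_norm (\<lambda>x. f x + g x) \<le> l2_norm f + l2_norm g"
proof -
  note [measurable] = f[THEN square_integrable_measurable] g[THEN square_integrable_measurable]
  have If: "integrable lborel (\<lambda>x. (norm (f x))\<^sup>2)" and Ig: "integrable lborel (\<lambda>x. (norm (g x))\<^sup>2)"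
    using f g by (auto simp: square_integrable_def)
  have Ifg: "integrable lborel (\<lambda>x. norm (f x) * norm (g x))"
  proof (rule Bochner_Integration.integrable_bound)
    show "integrable lborel (\<lambda>x. (norm (f x))\<^sup>2 + (norm (g x))\<^sup>2)" using If Ig by simp
    have "norm (f x) * norm (g x) \<le> (norm (f x))\<^sup>2 + (norm (g x))\<^sup>2" for x
      using sum_squares_bound[of "norm (f x)" "norm (g x)"] 
        mult_nonneg_nonneg[OF norm_ge_zero[of "f x"] norm_ge_zero[of "g x"]]
      by linarith
    then show "AE x in lborel. norm (norm (f x) * norm (g x)) \<le> norm ((norm (f x))\<^sup>2 + (norm (g x))\<^sup>2)"
      by simp
  qed measurable
  let ?A = "LINT x|lborel. (norm (f x))\<^sup>2" and ?B = "LINT x|lborel. (norm (g x))\<^sup>2"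
  let ?C = "LINT x|lborel. norm (f x) * norm (g x)"
  have "(\<integral>\<^sup>+x. ennreal (norm (f x)) * ennreal (norm (g x)) \<partial>lborel)\<^sup>2
      \<le> (\<integral>\<^sup>+x. (ennreal (norm (f x)))\<^sup>2 \<partial>lborel) * (\<integral>\<^sup>+x. (ennreal (norm (g x)))\<^sup>2 \<partial>lborel)"
    by (rule Cauchy_Schwarz_nn_integral) measurable
  also have "\<dots> = ennreal (?A * ?B)"
    by (simp add: ennreal_power nn_integral_eq_integral If Ig ennreal_mult)
  also have "(\<integral>\<^sup>+x. ennreal (norm (f x)) * ennreal (norm (g x)) \<partial>lborel) = ennreal ?C"
    by (simp add: nn_integral_eq_integral Ifg flip: ennreal_mult)
  finally have "?C\<^sup>2 \<le> ?A * ?B"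
    by (simp add: ennreal_power ennreal_le_iff)
  then have C: "?C \<le> sqrt ?A * sqrt ?B"
    unfolding real_sqrt_mult[symmetric] by (rule real_le_rsqrt)
  have "(LINT x|lborel. (norm (f x + g x))\<^sup>2)
      \<le> (LINT x|lborel. (norm (f x))\<^sup>2 + 2 * (norm (f x) * norm (g x)) + (norm (g x))\<^sup>2)"
  proof (rule integral_mono)
    show "integrable lborel (\<lambda>x. (norm (f x + g x))\<^sup>2)"
      using square_integrable_add[OF f g] by (simp add: square_integrable_def)
    show "integrable lborel
        (\<lambda>x. (norm (f x))\<^sup>2 + 2 * (norm (f x) * norm (g x)) + (norm (g x))\<^sup>2)"
      using If Ig Ifg by simp
    fix x
    have "(norm (f x + g x))\<^sup>2 \<le> (norm (f x) + norm (g x))\<^sup>2"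
      by (intro power_mono norm_triangle_ineq) auto
    then show "(norm (f x + g x))\<^sup>2
        \<le> (norm (f x))\<^sup>2 + 2 * (norm (f x) * norm (g x)) + (norm (g x))\<^sup>2"
      by (simp add: power2_sum algebra_simps)
  qed
  also have "\<dots> = ?A + 2 * ?C + ?B" using If Ig Ifg by simp
  also have "\<dots> \<le> (sqrt ?A + sqrt ?B)\<^sup>2"
    using C by (simp add: power2_sum)
  finally show ?thesis
    unfolding l2_norm_def by (intro real_le_lsqrt) auto
qed

instantiation L2 :: (euclidean_space, "{banach, second_countable_topology}") real_normed_vector
begin

lift_definition norm_L2 :: "('a, 'b) L2 \<Rightarrow> real" is l2_norm
  unfolding l2_norm_def l2_equal_def
  by (auto simp: square_integrable_def intro!: integral_cong_AE)

definition dist_L2 :: "('a, 'b) L2 \<Rightarrow> ('a, 'b) L2 \<Rightarrow> real" where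
  "dist_L2 f g = norm (f - g)"

definition uniformity_L2 :: "(('a, 'b) L2 \<times> ('a, 'b) L2) filter" where
  "uniformity_L2 = (INF e\<in>{0 <..}. principal {(f, g). dist f g < e})"

definition open_L2 :: "('a, 'b) L2 set \<Rightarrow> bool" where
  "open_L2 U = (\<forall>f\<in>U. eventually (\<lambda>(f', g). f' = f \<longrightarrow> g \<in> U) uniformity)"

definition sgn_L2 :: "('a, 'b) L2 \<Rightarrow> ('a, 'b) L2" where
  "sgn_L2 f = f /\<^sub>R norm f"

instance
proof
  fix f g :: "('a, 'b) L2" and c :: real
  show "norm (f + g) \<le> norm f + norm g"
    by transfer (simp add: l2_equal_def l2_norm_triangle)
  show "norm (c *\<^sub>R f) = \<bar>c\<bar> * norm f"
    by transfer (simp add: l2_norm_def power_mult_distrib real_sqrt_mult)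
  show "norm f = 0 \<longleftrightarrow> f = 0"
  proof transfer
    fix f :: "'a \<Rightarrow> 'b" assume "l2_equal f f"
    then have f: "square_integrable f" by (simp add: l2_equal_def)
    then have "l2_norm f = 0 \<longleftrightarrow> (AE x in lborel. (norm (f x))\<^sup>2 = 0)"
      unfolding l2_norm_def real_sqrt_eq_0_iff
      by (intro integral_nonneg_eq_0_iff_AE) (auto simp: square_integrable_def)
    with f show "l2_norm f = 0 \<longleftrightarrow> l2_equal f (\<lambda>x. 0)"
      by (simp add: l2_equal_def)
  qed
qed (rule dist_L2_def uniformity_L2_def open_L2_def sgn_L2_def)+

end

lemma square_integrable_rep [simp]: "square_integrable (rep_L2 f)"
  using Quotient_rep_reflp[OF Quotient_L2, of f] by (simp add: l2_equal_def)

lemma measurable_rep_L2 [measurable]: "rep_L2 f \<in> borel_measurable lborel"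
  by (rule square_integrable_measurable[OF square_integrable_rep])

lemma abs_rep_L2 [simp]: "abs_L2 (rep_L2 f) = f"
  by (rule Quotient_abs_rep[OF Quotient_L2])

lemma rep_abs_L2: "square_integrable f \<Longrightarrow> AE x in lborel. rep_L2 (abs_L2 f) x = f x"
  using Quotient_rep_abs[OF Quotient_L2, of f] by (simp add: l2_equal_def)

lemma norm_abs_L2: "square_integrable f \<Longrightarrow> norm (abs_L2 f) = l2_norm f"
  by (rule norm_L2.abs_eq) (simp add: l2_equal_def)

lemma abs_L2_diff:
  "square_integrable f \<Longrightarrow> square_integrable g \<Longrightarrow>
     abs_L2 f - abs_L2 g = abs_L2 (\<lambda>x. f x - g x)"
  by (rule minus_L2.abs_eq) (simp_all add: l2_equal_def)

lemma abs_L2_add: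
  "square_integrable f \<Longrightarrow> square_integrable g \<Longrightarrow>
     abs_L2 f + abs_L2 g = abs_L2 (\<lambda>x. f x + g x)"
  by (rule plus_L2.abs_eq) (simp_all add: l2_equal_def)

lemma norm_diff_L2_sq:
  "ennreal ((norm (f - g))\<^sup>2) = (\<integral>\<^sup>+x. ennreal ((norm (rep_L2 f x - rep_L2 g x))\<^sup>2) \<partial>lborel)"
proof -
  have s: "square_integrable (\<lambda>x. rep_L2 f x - rep_L2 g x)"
    by (intro square_integrable_diff) auto
  have "norm (f - g) = l2_norm (\<lambda>x. rep_L2 f x - rep_L2 g x)"
    using norm_abs_L2[OF s] abs_L2_diff[of "rep_L2 f" "rep_L2 g"] by simp
  then show ?thesis
    using s by (simp add: l2_norm_def square_integrable_def nn_integral_eq_integral)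
qed

instance L2 :: (euclidean_space, "{banach, second_countable_topology}") banach
proof
  fix X :: "nat \<Rightarrow> ('a, 'b) L2" assume X: "Cauchy X"
  have "\<forall>k. \<exists>N. \<forall>m\<ge>N. \<forall>n\<ge>N. dist (X m) (X n) < (1/2)^k"
  proof
    fix k :: nat
    show "\<exists>N. \<forall>m\<ge>N. \<forall>n\<ge>N. dist (X m) (X n) < (1/2)^k"
      by (rule metric_CauchyD[OF X]) simp
  qed
  from choice[OF this] obtain N
    where N: "\<And>k m n. m \<ge> N k \<Longrightarrow> n \<ge> N k \<Longrightarrow> dist (X m) (X n) < (1/2)^k"
    by blast
  define r where "r k = (\<Sum>j\<le>k. N j) + k" for k
  have rN: "r k \<ge> N k" for k
    unfolding r_def by (cases k) (auto simp: atMost_Suc)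
  have r: "strict_mono r"
    unfolding strict_mono_Suc_iff r_def by simp
  have step: "dist (X (r (Suc k))) (X (r k)) < (1/2)^k" for k
  proof (rule N)
    have "r k \<le> r (Suc k)" using r by (simp add: strict_mono_less_eq)
    then show "r (Suc k) \<ge> N k" using rN[of k] by simp
  qed (rule rN)
  define f where "f k = rep_L2 (X (r k))" for k
  have [measurable]: "f k \<in> borel_measurable lborel" for k
    by (simp add: f_def)
  define d where "d k x = norm (f (Suc k) x - f k x)" for k x
  have [measurable]: "d k \<in> borel_measurable lborel" for k
    unfolding d_def by measurable
  have dk: "(\<integral>\<^sup>+x. ennreal (2^k * (d k x)\<^sup>2) \<partial>lborel) \<le> ennreal ((1/2)^k)" for k
  proof -
    have "(\<integral>\<^sup>+x. ennreal (2^k * (d k x)\<^sup>2) \<partial>lborel)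
        = ennreal (2^k) * (\<integral>\<^sup>+x. ennreal ((d k x)\<^sup>2) \<partial>lborel)"
      by (simp add: ennreal_mult nn_integral_cmult del: ennreal_power)
    also have "(\<integral>\<^sup>+x. ennreal ((d k x)\<^sup>2) \<partial>lborel) = ennreal ((norm (X (r (Suc k)) - X (r k)))\<^sup>2)"
      by (simp add: d_def f_def norm_diff_L2_sq)
    also have "ennreal (2^k) * \<dots> = ennreal (2^k * (norm (X (r (Suc k)) - X (r k)))\<^sup>2)"
      by (simp add: ennreal_mult)
    also have "\<dots> \<le> ennreal (2^k * ((1/2)^k)\<^sup>2)"
      using step[of k] by (intro ennreal_leI mult_left_mono power_mono) (auto simp: dist_norm)
    also have "2^k * ((1/2)^k)\<^sup>2 = ((1/2)^k :: real)"
      by (simp add: power2_eq_square field_simps)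
    finally show ?thesis .
  qed
  have "(\<integral>\<^sup>+x. (\<Sum>k. ennreal (2^k * (d k x)\<^sup>2)) \<partial>lborel)
      = (\<Sum>k. \<integral>\<^sup>+x. ennreal (2^k * (d k x)\<^sup>2) \<partial>lborel)"
    by (rule nn_integral_suminf) measurable
  also have "\<dots> \<le> (\<Sum>k. ennreal ((1/2)^k))"
    by (intro suminf_le dk) auto
  also have "\<dots> < \<infinity>"
    by (subst suminf_ennreal2) (auto simp: summable_geometric)
  finally have "AE x in lborel. (\<Sum>k. ennreal (2^k * (d k x)\<^sup>2)) \<noteq> \<infinity>"
    by (intro nn_integral_noteq_infinite) auto
  then have conv: "AE x in lborel. convergent (\<lambda>k. f k x)"
  proof eventually_elim
    fix x assume "(\<Sum>k. ennreal (2^k * (d k x)\<^sup>2)) \<noteq> \<infinity>"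
    then have "summable (\<lambda>k. 2^k * (d k x)\<^sup>2)"
      by (intro summable_suminf_not_top) auto
    then have "Bseq (\<lambda>k. 2^k * (d k x)\<^sup>2)"
      by (intro convergent_imp_Bseq convergentI[OF summable_LIMSEQ_zero])
    then obtain C where C: "C > 0" "\<And>k. 2^k * (d k x)\<^sup>2 \<le> C"
      unfolding Bseq_def by (auto simp: abs_mult)
    have "d k x \<le> sqrt C * sqrt (1/2)^k" for k
    proof -
      have "(d k x)\<^sup>2 \<le> C * (1/2)^k"
        using C(2)[of k] by (simp add: field_simps)
      then have "d k x \<le> sqrt (C * (1/2)^k)" by (rule real_le_rsqrt)
      then show ?thesis by (simp add: real_sqrt_mult real_sqrt_power)
    qed
    moreover have "summable (\<lambda>k. sqrt C * sqrt (1/2)^k)"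
      by (rule summable_mult, rule summable_geometric) (simp add: real_sqrt_divide)
    ultimately have "summable (\<lambda>k. f (Suc k) x - f k x)"
      by (rule_tac summable_comparison_test'[of "\<lambda>k. sqrt C * sqrt (1/2)^k" 0]) (auto simp: d_def)
    then have "convergent (\<lambda>n. \<Sum>k<n. f (Suc k) x - f k x)"
      by (simp add: summable_iff_convergent)
    then obtain l where "(\<lambda>n. f n x - f 0 x) \<longlonglongrightarrow> l"
      using sum_lessThan_telescope[of "\<lambda>k. f k x"] by (auto simp: convergent_def)
    from tendsto_add[OF this tendsto_const[of "f 0 x"]]
    show "convergent (\<lambda>k. f k x)" by (auto intro: convergentI)
  qed
  define F where "F x = lim (\<lambda>k. f k x)" for x
  have Fm [measurable]: "F \<in> borel_measurable lborel"
    unfolding F_def by measurable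
  have lim: "AE x in lborel. (\<lambda>k. f k x) \<longlonglongrightarrow> F x"
    using conv by eventually_elim (auto simp: F_def convergent_LIMSEQ_iff)
  have fatou: "(\<integral>\<^sup>+x. ennreal ((norm (F x - rep_L2 (X n) x))\<^sup>2) \<partial>lborel) \<le> ennreal (((1/2)^k)\<^sup>2)"
    if n: "n \<ge> N k" for n k
  proof -
    have "(\<integral>\<^sup>+x. ennreal ((norm (F x - rep_L2 (X n) x))\<^sup>2) \<partial>lborel)
        = (\<integral>\<^sup>+x. liminf (\<lambda>m. ennreal ((norm (f m x - rep_L2 (X n) x))\<^sup>2)) \<partial>lborel)"
    proof (rule nn_integral_cong_AE, use lim in eventually_elim)
      fix x assume "(\<lambda>k. f k x) \<longlonglongrightarrow> F x"
      then have "(\<lambda>m. ennreal ((norm (f m x - rep_L2 (X n) x))\<^sup>2))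
          \<longlonglongrightarrow> ennreal ((norm (F x - rep_L2 (X n) x))\<^sup>2)"
        by (intro tendsto_ennrealI tendsto_intros)
      then show "ennreal ((norm (F x - rep_L2 (X n) x))\<^sup>2)
          = liminf (\<lambda>m. ennreal ((norm (f m x - rep_L2 (X n) x))\<^sup>2))"
        by (rule lim_imp_Liminf[OF trivial_limit_sequentially, symmetric])
    qed
    also have "\<dots> \<le> liminf (\<lambda>m. \<integral>\<^sup>+x. ennreal ((norm (f m x - rep_L2 (X n) x))\<^sup>2) \<partial>lborel)"
      by (rule nn_integral_liminf) measurable
    also have "\<dots> \<le> liminf (\<lambda>m. ennreal (((1/2)^k)\<^sup>2))"
    proof (rule Liminf_mono, rule eventually_sequentiallyI)
      fix m assume "m \<ge> N k"
      then have "r m \<ge> N k" using strict_mono_imp_increasing[OF r, of m] by simp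
      then have "norm (X (r m) - X n) < (1/2)^k"
        using N[OF _ n] by (simp add: dist_norm)
      then show "(\<integral>\<^sup>+x. ennreal ((norm (f m x - rep_L2 (X n) x))\<^sup>2) \<partial>lborel) \<le> ennreal (((1/2)^k)\<^sup>2)"
        unfolding f_def norm_diff_L2_sq[symmetric] by (intro ennreal_leI power_mono) auto
    qed
    also have "\<dots> = ennreal (((1/2)^k)\<^sup>2)"
      by (rule Liminf_const) simp
    finally show ?thesis .
  qed
  have sq: "square_integrable (\<lambda>x. F x - rep_L2 (X n) x)" if "n \<ge> N 0" for n
    unfolding square_integrable_def
  proof (intro conjI integrableI_bounded)
    show "(\<integral>\<^sup>+x. ennreal (norm ((norm (F x - rep_L2 (X n) x))\<^sup>2)) \<partial>lborel) < \<infinity>"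
      using fatou[OF that] by (simp add: order.strict_trans1)
  qed measurable
  have sqF: "square_integrable F"
    using square_integrable_add[OF sq[OF order_refl] square_integrable_rep[of "X (N 0)"]] by simp
  have "X \<longlonglongrightarrow> abs_L2 F"
  proof (rule metric_LIMSEQ_I)
    fix e :: real assume "e > 0"
    then obtain k where k: "(1/2)^k < e" using real_arch_pow_inv[of e "1/2"] by auto
    show "\<exists>no. \<forall>n\<ge>no. dist (X n) (abs_L2 F) < e"
    proof (intro exI allI impI)
      fix n assume n: "n \<ge> N k"
      have "ennreal ((norm (abs_L2 F - X n))\<^sup>2)
          = (\<integral>\<^sup>+x. ennreal ((norm (rep_L2 (abs_L2 F) x - rep_L2 (X n) x))\<^sup>2) \<partial>lborel)"
        by (rule norm_diff_L2_sq)
      also have "\<dots> = (\<integral>\<^sup>+x. ennreal ((norm (F x - rep_L2 (X n) x))\<^sup>2) \<partial>lborel)"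
        by (rule nn_integral_cong_AE, use rep_abs_L2[OF sqF] in eventually_elim) simp
      also have "\<dots> \<le> ennreal (((1/2)^k)\<^sup>2)" by (rule fatou[OF n])
      finally have "(norm (abs_L2 F - X n))\<^sup>2 \<le> ((1/2)^k)\<^sup>2"
        by (simp add: ennreal_le_iff)
      then have "norm (abs_L2 F - X n) \<le> (1/2)^k"
        by (rule power2_le_imp_le) simp
      then show "dist (X n) (abs_L2 F) < e"
        using k by (simp add: dist_norm norm_minus_commute)
    qed
  qed
  then show "convergent X" by (rule convergentI)
qed

lemma L2_tendsto_dominated:
  fixes g :: "'a::euclidean_space \<Rightarrow> 'b::{banach, second_countable_topology}"
  assumes f: "\<And>n. f n \<in> borel_measurable lborel" and g: "g \<in> borel_measurable lborel"
    and h: "integrable lborel h"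
    and fh: "\<And>n x. (norm (f n x))\<^sup>2 \<le> h x" and gh: "\<And>x. (norm (g x))\<^sup>2 \<le> h x"
    and lim: "\<And>x. (\<lambda>n. f n x) \<longlonglongrightarrow> g x"
  shows "(\<lambda>n. abs_L2 (f n)) \<longlonglongrightarrow> abs_L2 g"
proof -
  note [measurable] = f g
  have sf: "square_integrable (f n)" for n
    by (rule square_integrable_dominated[OF f h fh])
  have sg: "square_integrable g"
    by (rule square_integrable_dominated[OF g h gh])
  have hm [measurable]: "h \<in> borel_measurable lborel" using h by auto
  have "(\<lambda>n. LINT x|lborel. (norm (f n x - g x))\<^sup>2) \<longlonglongrightarrow> (LINT x|(lborel :: 'a measure). 0 :: real)"
  proof (rule integral_dominated_convergence[where w = "\<lambda>x. 4 * h x"])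
    show "integrable lborel (\<lambda>x. 4 * h x)" using h by simp
    show "AE x in lborel. (\<lambda>n. (norm (f n x - g x))\<^sup>2) \<longlonglongrightarrow> (0 :: real)"
    proof (rule AE_I2)
      fix x
      have "(\<lambda>n. (norm (f n x - g x))\<^sup>2) \<longlonglongrightarrow> (norm (g x - g x))\<^sup>2"
        by (intro tendsto_power tendsto_norm tendsto_diff lim tendsto_const)
      then show "(\<lambda>n. (norm (f n x - g x))\<^sup>2) \<longlonglongrightarrow> (0 :: real)" by simp
    qed
    show "AE x in lborel. norm ((norm (f n x - g x))\<^sup>2) \<le> 4 * h x" for n
    proof (rule AE_I2)
      fix x
      show "norm ((norm (f n x - g x))\<^sup>2) \<le> 4 * h x"
        using norm_add_sq_le[of "f n x" "- g x"] fh[of n x] gh[of x] by simp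
    qed
  qed measurable
  then have "(\<lambda>n. sqrt (LINT x|lborel. (norm (f n x - g x))\<^sup>2)) \<longlonglongrightarrow> sqrt 0"
    by (intro tendsto_real_sqrt) simp
  then have "(\<lambda>n. norm (abs_L2 (f n) - abs_L2 g)) \<longlonglongrightarrow> 0"
    by (simp add: abs_L2_diff sf sg norm_abs_L2 square_integrable_diff l2_norm_def)
  then show ?thesis
    by (subst LIM_zero_iff[symmetric]) (rule tendsto_norm_zero_cancel)
qed

lemma indicator_scaleR_norm_sq:
  "(norm (indicator A x *\<^sub>R c))\<^sup>2 = indicator A x * (norm c)\<^sup>2"
  by (simp split: split_indicator)

lemma borel_measurable_indicator_scaleR:
  fixes c :: "'b::{banach, second_countable_topology}"
  shows "A \<in> sets borel \<Longrightarrow> (\<lambda>x. indicator A x *\<^sub>R c) \<in> borel_measurable borel"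
  by (intro borel_measurable_scaleR borel_measurable_indicator) auto

lemma square_integrable_indicator:
  assumes "A \<in> sets borel" "emeasure lborel A < \<infinity>"
  shows "square_integrable (\<lambda>x. indicator A x *\<^sub>R c)"
proof (rule square_integrable_dominated)
  show "integrable lborel (\<lambda>x. indicator A x * (norm c)\<^sup>2)"
    using assms by (intro integrable_mult_left integrable_real_indicator) auto
qed (use assms in \<open>auto simp: indicator_scaleR_norm_sq intro!: borel_measurable_indicator_scaleR
    split: split_indicator\<close>)

lemma L2_subspace_total:
  fixes S :: "('a::euclidean_space, 'b::{banach, second_countable_topology}) L2 set"
  assumes G: "Int_stable G" "UNIV \<in> G" "sets borel = sigma_sets UNIV G"
    and S0: "0 \<in> S" and Sadd: "\<And>f g. f \<in> S \<Longrightarrow> g \<in> S \<Longrightarrow> f + g \<in> S"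
    and Smin: "\<And>f. f \<in> S \<Longrightarrow> - f \<in> S" and Sclosed: "closed S"
    and SG: "\<And>A n c. A \<in> G \<Longrightarrow> abs_L2 (\<lambda>x. indicator (A \<inter> ball 0 (real n)) x *\<^sub>R c) \<in> S"
  shows "S = UNIV"
proof -
  have Slim: "l \<in> S" if "\<And>n. s n \<in> S" "s \<longlonglongrightarrow> l" for s l
    using Sclosed that by (auto simp: closed_sequential_limits)
  have Ball: "emeasure lborel (A \<inter> ball 0 (real n)) < \<infinity>" if "A \<in> sets borel" for A :: "'a set" and n
  proof -
    have "emeasure lborel (A \<inter> ball 0 (real n)) \<le> emeasure lborel (ball (0::'a) (real n))"
      by (rule emeasure_mono) auto
    then show ?thesis using emeasure_bounded_finite[of "ball (0::'a) (real n)"]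
      by (auto simp: order.strict_trans1)
  qed
  have I1: "abs_L2 (\<lambda>x. indicator (A \<inter> ball 0 (real n)) x *\<^sub>R c) \<in> S"
    if A: "A \<in> sets borel" for A n and c :: 'b
  proof -
    have Gsub: "G \<subseteq> Pow UNIV" by simp
    have A': "A \<in> sigma_sets UNIV G" using A G(3) by simp
    note sq = square_integrable_indicator[OF _ Ball, of _ n]
    from G(1) Gsub A' show ?thesis
    proof (induction A arbitrary: c rule: sigma_sets_induct_disjoint)
      case (basic A)
      then show ?case by (rule SG)
    next
      case empty
      show ?case using S0 by (simp add: zero_L2_def map_fun_def)
    next
      case (compl A)
      then have A: "A \<in> sets borel" using G(3) by simp
      have "abs_L2 (\<lambda>x. indicator (UNIV \<inter> ball 0 (real n)) x *\<^sub>R c)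
          + - abs_L2 (\<lambda>x. indicator (A \<inter> ball 0 (real n)) x *\<^sub>R c) \<in> S"
        by (intro Sadd Smin SG G compl)
      also have "abs_L2 (\<lambda>x. indicator (UNIV \<inter> ball 0 (real n)) x *\<^sub>R c)
          + - abs_L2 (\<lambda>x. indicator (A \<inter> ball 0 (real n)) x *\<^sub>R c)
          = abs_L2 (\<lambda>x. indicator (UNIV \<inter> ball 0 (real n)) x *\<^sub>R c
              - indicator (A \<inter> ball 0 (real n)) x *\<^sub>R c)"
        unfolding add_uminus_conv_diff using A by (intro abs_L2_diff sq) auto
      also have "(\<lambda>x. indicator (UNIV \<inter> ball 0 (real n)) x *\<^sub>R c
              - indicator (A \<inter> ball 0 (real n)) x *\<^sub>R c)
          = (\<lambda>x. indicator ((UNIV - A) \<inter> ball 0 (real n)) x *\<^sub>R c)"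
        by (rule ext) (simp split: split_indicator)
      finally show ?case .
    next
      case (union A)
      then have A: "A i \<in> sets borel" for i using G(3) by auto
      then have UA: "(\<Union>i<m. A i) \<in> sets borel" for m :: nat by auto
      have step: "abs_L2 (\<lambda>x. indicator ((\<Union>i<m. A i) \<inter> ball 0 (real n)) x *\<^sub>R c) \<in> S" for m
      proof (induction m)
        case 0
        show ?case using S0 by (simp add: zero_L2_def map_fun_def)
      next
        case (Suc m)
        have "abs_L2 (\<lambda>x. indicator ((\<Union>i<m. A i) \<inter> ball 0 (real n)) x *\<^sub>R c)
            + abs_L2 (\<lambda>x. indicator (A m \<inter> ball 0 (real n)) x *\<^sub>R c) \<in> S"
          by (intro Sadd Suc union)
        also have "abs_L2 (\<lambda>x. indicator ((\<Union>i<m. A i) \<inter> ball 0 (real n)) x *\<^sub>R c)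
            + abs_L2 (\<lambda>x. indicator (A m \<inter> ball 0 (real n)) x *\<^sub>R c)
            = abs_L2 (\<lambda>x. indicator ((\<Union>i<m. A i) \<inter> ball 0 (real n)) x *\<^sub>R c
                + indicator (A m \<inter> ball 0 (real n)) x *\<^sub>R c)"
          using A UA by (intro abs_L2_add sq) auto
        also have "(\<lambda>x. indicator ((\<Union>i<m. A i) \<inter> ball 0 (real n)) x *\<^sub>R c
                + indicator (A m \<inter> ball 0 (real n)) x *\<^sub>R c)
            = (\<lambda>x. indicator ((\<Union>i<Suc m. A i) \<inter> ball 0 (real n)) x *\<^sub>R c)"
        proof
          fix x
          have "x \<notin> A m" if "i < m" "x \<in> A i" for i
            using disjoint_family_onD[OF union(1), of i m] that by auto
          then show "indicator ((\<Union>i<m. A i) \<inter> ball 0 (real n)) x *\<^sub>R c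
                + indicator (A m \<inter> ball 0 (real n)) x *\<^sub>R c
              = indicator ((\<Union>i<Suc m. A i) \<inter> ball 0 (real n)) x *\<^sub>R c"
            by (auto simp: indicator_def less_Suc_eq)
        qed
        finally show ?case .
      qed
      show ?case
      proof (rule Slim[OF step], rule L2_tendsto_dominated)
        show "integrable lborel (\<lambda>x :: 'a. indicator (UNIV \<inter> ball 0 (real n)) x * (norm c)\<^sup>2)"
          using Ball[of UNIV n]
          by (intro integrable_mult_left integrable_real_indicator) auto
        show "(\<lambda>m. indicator ((\<Union>i<m. A i) \<inter> ball 0 (real n)) x *\<^sub>R c)
            \<longlonglongrightarrow> indicator (\<Union> (range A) \<inter> ball 0 (real n)) x *\<^sub>R c" for x
          unfolding indicator_inter_arith
          by (intro tendsto_scaleR tendsto_mult LIMSEQ_indicator_UN tendsto_const)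
      qed (use A UA in \<open>auto simp: indicator_scaleR_norm_sq intro!: borel_measurable_indicator_scaleR
          split: split_indicator\<close>)
    qed
  qed
  have I2: "abs_L2 (\<lambda>x. indicator A x *\<^sub>R c) \<in> S"
    if A: "A \<in> sets borel" "emeasure lborel A < \<infinity>" for A and c :: 'b
  proof (rule Slim[OF I1[OF A(1)]], rule L2_tendsto_dominated)
    show "integrable lborel (\<lambda>x. indicator A x * (norm c)\<^sup>2)"
      using A by (intro integrable_mult_left integrable_real_indicator) auto
    fix x
    have ev: "\<forall>\<^sub>F n in sequentially. indicator A x *\<^sub>R c = indicator (A \<inter> ball 0 (real n)) x *\<^sub>R c"
    proof -
      obtain N :: nat where "norm x < real N" using reals_Archimedean2 by blast
      then have "\<And>n. n \<ge> N \<Longrightarrow> x \<in> ball 0 (real n)" by auto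
      then show ?thesis
        unfolding eventually_sequentially by (intro exI[of _ N]) (auto simp: indicator_def)
    qed
    show "(\<lambda>n. indicator (A \<inter> ball 0 (real n)) x *\<^sub>R c) \<longlonglongrightarrow> indicator A x *\<^sub>R c"
      by (rule Lim_transform_eventually[OF tendsto_const ev])
  qed (use A in \<open>auto simp: indicator_scaleR_norm_sq intro!: borel_measurable_indicator_scaleR
          split: split_indicator\<close>)
  have "f \<in> S" for f :: "('a, 'b) L2"
  proof -
    let ?f = "rep_L2 f"
    obtain F where F: "\<And>i. simple_function lborel (F i)" "\<And>x. (\<lambda>i. F i x) \<longlonglongrightarrow> ?f x"
        "\<And>i x. norm (F i x) \<le> 2 * norm (?f x)"
      using borel_measurable_implies_sequence_metric[OF measurable_rep_L2[of f], of 0] by auto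
    have int: "integrable lborel (\<lambda>x. 4 * (norm (?f x))\<^sup>2)"
      using square_integrable_rep[of f] by (simp add: square_integrable_def)
    have F2: "(norm (F i x))\<^sup>2 \<le> 4 * (norm (?f x))\<^sup>2" for i x
      using power_mono[OF F(3)[of i x], of 2] by (simp add: power_mult_distrib)
    have Fm [measurable]: "F i \<in> borel_measurable lborel" for i
      by (rule borel_measurable_simple_function[OF F(1)])
    have FS: "abs_L2 (F i) \<in> S" for i
    proof -
      have pre: "F i -` {y} \<in> sets borel" for y
        using simple_functionD(2)[OF F(1)[of i], of "{y}"] by simp
      have em: "emeasure lborel (F i -` {y}) < \<infinity>" if "y \<noteq> 0" for y
      proof -
        have "integrable lborel (\<lambda>x. indicator (F i -` {y}) x * (norm y)\<^sup>2 :: real)"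
        proof (rule Bochner_Integration.integrable_bound[OF int])
          show "AE x in lborel. norm (indicator (F i -` {y}) x * (norm y)\<^sup>2 :: real)
              \<le> norm (4 * (norm (?f x))\<^sup>2)"
            using F2[of i] by (intro AE_I2) (auto simp: indicator_def)
        qed (use pre[of y] in simp)
        then have "integrable lborel (\<lambda>x. (indicator (F i -` {y}) x * (norm y)\<^sup>2) * inverse ((norm y)\<^sup>2))"
          by (rule integrable_mult_left)
        with that have "integrable lborel (indicator (F i -` {y}) :: 'a \<Rightarrow> real)"
          by (simp add: mult.assoc)
        then show ?thesis by (simp add: integrable_indicator_iff)
      qed
      define t where "t y x = indicator (F i -` {y}) x *\<^sub>R y" for y x
      have t: "square_integrable (t y)" "abs_L2 (t y) \<in> S" if "y \<noteq> 0" for y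
        unfolding t_def using square_integrable_indicator[OF pre em] I2[OF pre em] that by auto
      have sum: "square_integrable (\<lambda>x. \<Sum>y\<in>Y. t y x) \<and> abs_L2 (\<lambda>x. \<Sum>y\<in>Y. t y x) \<in> S"
        if "finite Y" "0 \<notin> Y" for Y
        using that
      proof (induction Y rule: finite_induct)
        case empty
        show ?case using S0 by (simp add: zero_L2_def map_fun_def)
      next
        case (insert y Y)
        then show ?case
          using t[of y] by (simp add: square_integrable_add Sadd flip: abs_L2_add)
      qed
      have fin: "finite (range (F i) - {0})"
        using simple_functionD(1)[OF F(1)[of i]] by simp
      have "(\<lambda>x. \<Sum>y\<in>range (F i) - {0}. indicator (F i -` {y}) x *\<^sub>R y) = F i"
      proof
        fix x
        have "(\<Sum>y\<in>range (F i) - {0}. indicator (F i -` {y}) x *\<^sub>R y)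
            = (\<Sum>y\<in>range (F i) - {0}. if y = F i x then y else 0)"
          by (intro sum.cong) (auto simp: indicator_def)
        also have "\<dots> = F i x" using fin by (auto simp: sum.delta)
        finally show "(\<Sum>y\<in>range (F i) - {0}. indicator (F i -` {y}) x *\<^sub>R y) = F i x" .
      qed
      then show ?thesis using sum[OF fin] by (simp add: t_def)
    qed
    have "(\<lambda>i. abs_L2 (F i)) \<longlonglongrightarrow> abs_L2 ?f"
    proof (rule L2_tendsto_dominated[OF Fm measurable_rep_L2 int F2 _ F(2)])
      show "(norm (?f x))\<^sup>2 \<le> 4 * (norm (?f x))\<^sup>2" for x by simp
    qed
    then show ?thesis using Slim[OF FS] by simp
  qed
  then show ?thesis by auto
qed

instance L2 :: (euclidean_space, "{banach, second_countable_topology}") second_countable_topology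
proof
  obtain B :: "'a set set" where B: "countable B" "topological_basis B"
    using ex_countable_basis by blast
  obtain C :: "'b set" where C: "countable C" "\<And>X. open X \<Longrightarrow> X \<noteq> {} \<Longrightarrow> \<exists>d\<in>C. d \<in> X"
    by (erule countable_dense_setE)
  define G where "G = Inter ` {F. finite F \<and> F \<subseteq> B}"
  have cG: "countable G"
    unfolding G_def by (intro countable_image countable_Collect_finite_subset B)
  have BG: "B \<subseteq> G"
  proof
    fix b assume "b \<in> B"
    then show "b \<in> G" unfolding G_def by (intro image_eqI[of _ _ "{b}"]) auto
  qed
  have openG: "open A" if "A \<in> G" for A
    using that topological_basis_open[OF B(2)] by (auto simp: G_def intro!: open_Inter)
  have G1: "Int_stable G"
  proof (rule Int_stableI)
    fix a b assume "a \<in> G" "b \<in> G"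
    then obtain F F' where "finite F" "F \<subseteq> B" "a = \<Inter>F" "finite F'" "F' \<subseteq> B" "b = \<Inter>F'"
      by (auto simp: G_def)
    then show "a \<inter> b \<in> G"
      unfolding G_def by (intro image_eqI[of _ _ "F \<union> F'"]) auto
  qed
  have G2: "UNIV \<in> G"
    unfolding G_def by (rule image_eqI[of _ _ "{}"]) auto
  have G3: "sets borel = sigma_sets UNIV G"
  proof
    show "sets borel \<subseteq> sigma_sets UNIV G"
      using sigma_sets_subseteq[OF BG, of UNIV] by (simp add: borel_eq_countable_basis[OF B])
    show "sigma_sets UNIV G \<subseteq> sets borel"
      using openG by (intro borel_sigma_sets_subset) auto
  qed
  define D0 where "D0 = (\<lambda>(A, n, c). abs_L2 (\<lambda>x. indicator (A \<inter> ball 0 (real n)) x *\<^sub>R c))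
      ` (G \<times> (UNIV :: nat set) \<times> C)"
  define D where "D = (sum_list ` lists D0 :: ('a, 'b) L2 set)"
  have cD: "countable D"
    unfolding D_def D0_def by (intro countable_image countable_lists countable_SIGMA cG C) auto
  define S where "S = closure D"
  have S0: "0 \<in> S"
    unfolding S_def D_def by (rule subsetD[OF closure_subset], rule image_eqI[of _ _ "[]"]) auto
  have Sadd: "f + g \<in> S" if fg: "f \<in> S" "g \<in> S" for f g
  proof -
    from fg obtain u v where uv: "\<And>n. u n \<in> D" "u \<longlonglongrightarrow> f" "\<And>n. v n \<in> D" "v \<longlonglongrightarrow> g"
      unfolding S_def closure_sequential by auto
    have "u n + v n \<in> D" for n
    proof -
      from uv(1)[of n] uv(3)[of n] obtain xs ys
        where "xs \<in> lists D0" "u n = sum_list xs" "ys \<in> lists D0" "v n = sum_list ys"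
        by (auto simp: D_def)
      then show ?thesis
        unfolding D_def by (intro image_eqI[of _ _ "xs @ ys"]) auto
    qed
    then show ?thesis
      unfolding S_def closure_sequential using tendsto_add[OF uv(2,4)]
      by (intro exI[of _ "\<lambda>n. u n + v n"]) auto
  qed
  have SG: "abs_L2 (\<lambda>x. indicator (A \<inter> ball 0 (real n)) x *\<^sub>R c) \<in> S" if A: "A \<in> G" for A n c
  proof -
    have "c \<in> closure C"
      using C(2) by (auto simp: closure_iff_nhds_not_empty)
    then obtain u where u: "\<And>k. u k \<in> C" "u \<longlonglongrightarrow> c"
      unfolding closure_sequential by blast
    obtain K where K: "\<And>k. norm (u k) \<le> K"
      using convergent_imp_Bseq[OF convergentI[OF u(2)]] by (auto simp: Bseq_def)
    have Kc: "norm c \<le> K"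
      by (rule LIMSEQ_le_const2[OF tendsto_norm[OF u(2)]]) (use K in auto)
    have Ab: "A \<in> sets borel" using openG[OF A] by simp
    have "emeasure lborel (A \<inter> ball 0 (real n)) \<le> emeasure lborel (ball (0::'a) (real n))"
      by (rule emeasure_mono) auto
    then have em: "emeasure lborel (A \<inter> ball 0 (real n)) < \<infinity>"
      using emeasure_bounded_finite[of "ball (0::'a) (real n)"]
      by (auto simp: order.strict_trans1)
    have mem: "abs_L2 (\<lambda>x. indicator (A \<inter> ball 0 (real n)) x *\<^sub>R u k) \<in> D" for k
    proof -
      have "abs_L2 (\<lambda>x. indicator (A \<inter> ball 0 (real n)) x *\<^sub>R u k) \<in> D0"
        unfolding D0_def by (rule image_eqI[of _ _ "(A, n, u k)"]) (use A u in auto)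
      then show ?thesis
        unfolding D_def
        by (intro image_eqI[of _ _ "[abs_L2 (\<lambda>x. indicator (A \<inter> ball 0 (real n)) x *\<^sub>R u k)]"]) auto
    qed
    have "(\<lambda>k. abs_L2 (\<lambda>x. indicator (A \<inter> ball 0 (real n)) x *\<^sub>R u k))
        \<longlonglongrightarrow> abs_L2 (\<lambda>x. indicator (A \<inter> ball 0 (real n)) x *\<^sub>R c)"
    proof (rule L2_tendsto_dominated)
      show "integrable lborel (\<lambda>x. indicator (A \<inter> ball 0 (real n)) x * K\<^sup>2)"
        using Ab em by (intro integrable_mult_left integrable_real_indicator) auto
      show "(\<lambda>k. indicator (A \<inter> ball 0 (real n)) x *\<^sub>R u k)
          \<longlonglongrightarrow> indicator (A \<inter> ball 0 (real n)) x *\<^sub>R c" for x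
        by (intro tendsto_scaleR tendsto_const u)
    qed (use Ab K Kc in \<open>auto simp: indicator_scaleR_norm_sq
        intro!: borel_measurable_indicator_scaleR power_mono split: split_indicator\<close>)
    with mem show ?thesis
      unfolding S_def closure_sequential
      by (intro exI[of _ "\<lambda>k. abs_L2 (\<lambda>x. indicator (A \<inter> ball 0 (real n)) x *\<^sub>R u k)"]) auto
  qed
  have Dmin: "- f \<in> S" if "f \<in> D" for f
  proof -
    from that obtain xs where xs: "xs \<in> lists D0" "f = sum_list xs" by (auto simp: D_def)
    have "- sum_list xs \<in> S"
      using xs(1)
    proof (induction xs)
      case Nil
      show ?case using S0 by simp
    next
      case (Cons y ys)
      from Cons(1) obtain A n c where A: "A \<in> G"
        and y: "y = abs_L2 (\<lambda>x. indicator (A \<inter> ball 0 (real n)) x *\<^sub>R c)"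
        by (auto simp: D0_def)
      have "emeasure lborel (A \<inter> ball 0 (real n)) \<le> emeasure lborel (ball (0::'a) (real n))"
        by (rule emeasure_mono) auto
      then have em: "emeasure lborel (A \<inter> ball 0 (real n)) < \<infinity>"
        using emeasure_bounded_finite[of "ball (0::'a) (real n)"]
        by (auto simp: order.strict_trans1)
      have "l2_equal (\<lambda>x. indicator (A \<inter> ball 0 (real n)) x *\<^sub>R c)
          (\<lambda>x. indicator (A \<inter> ball 0 (real n)) x *\<^sub>R c)"
        using openG[OF A] em by (simp add: l2_equal_def square_integrable_indicator)
      then have "- y = abs_L2 (\<lambda>x. indicator (A \<inter> ball 0 (real n)) x *\<^sub>R (- c))"
        unfolding y by (subst uminus_L2.abs_eq) auto
      then have "- y \<in> S" using SG[OF A, of n "- c"] by simp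
      then have "- y + - sum_list ys \<in> S" by (rule Sadd) (rule Cons)
      then show ?case by simp
    qed
    then show ?thesis using xs by simp
  qed
  have Smin: "- f \<in> S" if f: "f \<in> S" for f
  proof -
    from f obtain u where u: "\<And>n. u n \<in> D" "u \<longlonglongrightarrow> f"
      unfolding S_def closure_sequential by blast
    have "closed S" by (simp add: S_def)
    then show ?thesis
      using Dmin[OF u(1)] tendsto_minus[OF u(2)]
      unfolding closed_sequential_limits by (elim allE[of _ "\<lambda>n. - u n"]) auto
  qed
  have "S = UNIV"
    by (rule L2_subspace_total[OF G1 G2 G3 S0 Sadd Smin _ SG]) (auto simp: S_def)
  then have dense: "closure D = UNIV" by (simp add: S_def)
  define T where "T = (\<lambda>(d, n). ball d (1 / real (Suc n))) ` (D \<times> UNIV)"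
  have "countable T"
    unfolding T_def by (intro countable_image countable_SIGMA cD) auto
  moreover have "topological_basis T"
  proof (rule topological_basisI)
    fix V :: "('a, 'b) L2 set" and f assume "open V" "f \<in> V"
    then obtain e where e: "e > 0" "ball f e \<subseteq> V"
      by (auto simp: open_contains_ball)
    obtain n where n: "1 / real (Suc n) < e / 2"
      using reals_Archimedean[of "e / 2"] e by (auto simp: inverse_eq_divide)
    have "f \<in> closure D" using dense by simp
    then obtain d where d: "d \<in> D" "dist d f < 1 / real (Suc n)"
      unfolding closure_approachable by (metis of_nat_0_less_iff zero_less_Suc zero_less_divide_1_iff)
    have "ball d (1 / real (Suc n)) \<subseteq> ball f e"
    proof
      fix g assume "g \<in> ball d (1 / real (Suc n))"
      then have "dist d g < 1 / real (Suc n)" by simp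
      with d n dist_triangle[of f g d] show "g \<in> ball f e"
        by (simp add: dist_commute[of f d])
    qed
    with d e show "\<exists>U\<in>T. f \<in> U \<and> U \<subseteq> V"
      by (intro bexI[of _ "ball d (1 / real (Suc n))"]) (auto simp: T_def)
  qed (auto simp: T_def)
  ultimately show "\<exists>B::('a, 'b) L2 set set. countable B \<and> open = generate_topology B"
    using topological_basis_imp_subbasis by blast
qed

definition L2_on :: "'a::euclidean_space set \<Rightarrow> ('a, 'b::{banach, second_countable_topology}) L2 set" where
  "L2_on U = {f. AE x in lborel. x \<notin> U \<longrightarrow> rep_L2 f x = 0}"


section \<open>Weak derivatives\<close>

primrec C_k :: "nat \<Rightarrow> ('a::euclidean_space \<Rightarrow> 'b::real_normed_vector) \<Rightarrow> bool" where
  "C_k 0 f \<longleftrightarrow> continuous_on UNIV f"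
| "C_k (Suc k) f \<longleftrightarrow>
     (\<forall>x. f differentiable (at x)) \<and> (\<forall>v. C_k k (\<lambda>x. frechet_derivative f (at x) v))"

definition C_infinity :: "('a::euclidean_space \<Rightarrow> 'b::real_normed_vector) \<Rightarrow> bool" where
  "C_infinity f \<longleftrightarrow> (\<forall>k. C_k k f)"

definition test_functions :: "'a::euclidean_space set \<Rightarrow> ('a \<Rightarrow> real) set" where
  "test_functions U =
     {\<eta>. C_infinity \<eta> \<and> compact (closure {x. \<eta> x \<noteq> 0}) \<and> closure {x. \<eta> x \<noteq> 0} \<subseteq> U}"

definition weak_partial ::
    "'a::euclidean_space set \<Rightarrow> 'a \<Rightarrow> ('a \<Rightarrow> 'b::{banach, second_countable_topology}) \<Rightarrow> ('a \<Rightarrow> 'b) \<Rightarrow> bool"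
  where
  "weak_partial U v f g \<longleftrightarrow>
     (\<forall>\<eta>\<in>test_functions U.
        (LINT x|lborel. frechet_derivative \<eta> (at x) v *\<^sub>R f x) = - (LINT x|lborel. \<eta> x *\<^sub>R g x))"

text \<open>Component \<open>i\<close> of the value of a gradient is the partial derivative in direction \<open>axis i 1\<close>.\<close>

definition weak_gradient ::
    "(real^2) set \<Rightarrow> (real^2, 'b::euclidean_space) L2 \<Rightarrow> (real^2, 'b^2) L2 \<Rightarrow> bool" where
  "weak_gradient \<Omega> f G \<longleftrightarrow>
     (\<forall>i. weak_partial \<Omega> (axis i 1) (rep_L2 f) (\<lambda>x. rep_L2 G x $ i))"


section \<open>Sobolev spaces on a planar domain\<close>

text \<open>
  A Sobolev function is represented together with its weak derivatives, which it determines
  uniquely. The norm that these spaces inherit from the ambient product is then exactly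
  \<open>\<parallel>f\<parallel>\<^sup>2 = \<parallel>f\<parallel>\<^bsub>L2\<^esub>\<^sup>2 + \<parallel>Df\<parallel>\<^bsub>L2\<^esub>\<^sup>2\<close> for \<open>sobolev_H1\<close>, and
  \<open>\<parallel>f\<parallel>\<^sup>2 = \<parallel>f\<parallel>\<^bsub>L2\<^esub>\<^sup>2 + \<parallel>Df\<parallel>\<^bsub>L2\<^esub>\<^sup>2 + \<parallel>DDf\<parallel>\<^bsub>L2\<^esub>\<^sup>2\<close> for \<open>sobolev_H2\<close>. Every ambient
  product is a separable Banach space, so functions of time with values in these spaces are
  covered by the Bochner integral and by \<open>L2\<close> itself.
\<close>

definition sobolev_H1 ::
    "(real^2) set \<Rightarrow> ((real^2, 'b::euclidean_space) L2 \<times> (real^2, 'b^2) L2) set" where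
  "sobolev_H1 \<Omega> = {(f, G). f \<in> L2_on \<Omega> \<and> G \<in> L2_on \<Omega> \<and> weak_gradient \<Omega> f G}"

type_synonym h1_vector = "(real^2, real^2) L2 \<times> (real^2, real^2^2) L2"
type_synonym h2_scalar = "(real^2, real) L2 \<times> (real^2, real^2) L2 \<times> (real^2, real^2^2) L2"

definition sobolev_H2 :: "(real^2) set \<Rightarrow> h2_scalar set" where
  "sobolev_H2 \<Omega> = {(f, G, H). (f, G) \<in> sobolev_H1 \<Omega> \<and> (G, H) \<in> sobolev_H1 \<Omega>}"


section \<open>Hausdorff measure, traces and the space of displacements\<close>

definition hausdorff1_content :: "real \<Rightarrow> 'a::metric_space set \<Rightarrow> ennreal" where
  "hausdorff1_content \<delta> A =
     (INF C \<in> {C :: nat \<Rightarrow> 'a set.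
          A \<subseteq> (\<Union>i. C i) \<and> (\<forall>i. bounded (C i) \<and> diameter (C i) \<le> \<delta>)}.
        \<Sum>i. ennreal (diameter (C i)))"

definition hausdorff1 :: "'a::metric_space set \<Rightarrow> ennreal" where
  "hausdorff1 A = (SUP \<delta>\<in>{0<..}. hausdorff1_content \<delta> A)"

text \<open>
  \<open>hausdorff1\<close> is a metric outer measure and hence countably additive on Borel sets, so
  \<open>measure_of\<close> yields its restriction to the Borel sets.
\<close>

definition hausdorff1_measure :: "'a::metric_space measure" where
  "hausdorff1_measure = measure_of UNIV (sets borel) hausdorff1"

definition restrict_L2 ::
    "(real^2) set \<Rightarrow> (real^2 \<Rightarrow> 'b::{banach, second_countable_topology}) \<Rightarrow> (real^2, 'b) L2" where
  "restrict_L2 \<Omega> f = abs_L2 (\<lambda>x. indicator \<Omega> x *\<^sub>R f x)"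

definition gradient :: "(real^2 \<Rightarrow> 'b::euclidean_space) \<Rightarrow> real^2 \<Rightarrow> 'b^2" where
  "gradient f x = (\<chi> i. frechet_derivative f (at x) (axis i 1))"

text \<open>
  The trace operator is the continuous extension to \<open>sobolev_H1 \<Omega>\<close> of the restriction of smooth
  functions to the boundary, with values in \<open>L2\<close> of the boundary with respect to arc length. For a
  bounded Lipschitz domain smooth functions on the plane are dense, so every Sobolev function has
  a trace, and it is unique up to null sets.
\<close>

definition has_trace ::
    "(real^2) set \<Rightarrow> (real^2, 'b::euclidean_space) L2 \<times> (real^2, 'b^2) L2 \<Rightarrow> (real^2 \<Rightarrow> 'b) \<Rightarrow> bool" where
  "has_trace \<Omega> v w \<longleftrightarrow>
     w \<in> borel_measurable borel \<and>
     (\<exists>f. (\<forall>k::nat. C_infinity (f k)) \<and>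
        (\<lambda>k. (restrict_L2 \<Omega> (f k), restrict_L2 \<Omega> (gradient (f k)))) \<longlonglongrightarrow> v \<and>
        (\<lambda>k. \<integral>\<^sup>+x\<in>frontier \<Omega>. ennreal ((norm (f k x - w x))\<^sup>2) \<partial>hausdorff1_measure) \<longlonglongrightarrow> 0)"

definition V_u :: "(real^2) set \<Rightarrow> (real^2) set \<Rightarrow> h1_vector set" where
  "V_u \<Omega> \<Gamma>\<^sub>D =
     {v \<in> sobolev_H1 \<Omega>. \<exists>w. has_trace \<Omega> v w \<and> (AE x in hausdorff1_measure. x \<in> \<Gamma>\<^sub>D \<longrightarrow> w x = 0)}"

abbreviation V_phi :: "(real^2) set \<Rightarrow> h2_scalar set" where
  "V_phi \<equiv> sobolev_H2"


section \<open>Lipschitz domains and regularity in the sense of Groeger\<close>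

text \<open>Near each boundary point the set lies strictly above a Lipschitz graph, in suitable
  orthonormal coordinates with axes \<open>e\<close> and \<open>n\<close>.\<close>

definition lipschitz_domain :: "(real^2) set \<Rightarrow> bool" where
  "lipschitz_domain \<Omega> \<longleftrightarrow>
     open \<Omega> \<and> connected \<Omega> \<and> \<Omega> \<noteq> {} \<and>
     (\<forall>x\<in>frontier \<Omega>. \<exists>r>0. \<exists>e n (\<gamma> :: real \<Rightarrow> real) L.
        norm e = 1 \<and> norm n = 1 \<and> e \<bullet> n = 0 \<and> L-lipschitz_on UNIV \<gamma> \<and>
        \<Omega> \<inter> ball x r = {y \<in> ball x r. (y - x) \<bullet> n > \<gamma> ((y - x) \<bullet> e)})"

text \<open>
  Groeger's definition: \<open>G\<close> is bounded, and around each boundary point of \<open>G\<close> a bi-Lipschitz map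
  takes \<open>G\<close> to one of the three model sets, which are the open lower half disc, this half disc
  with the flat part of its boundary, and this half disc with half of the flat part.
\<close>

definition groeger_E1 :: "(real^2) set" where
  "groeger_E1 = {y. norm y < 1 \<and> y $ 2 < 0}"

definition groeger_E2 :: "(real^2) set" where
  "groeger_E2 = {y. norm y < 1 \<and> y $ 2 \<le> 0}"

definition groeger_E3 :: "(real^2) set" where
  "groeger_E3 = {y \<in> groeger_E2. y $ 2 < 0 \<or> y $ 1 > 0}"

definition groeger_regular :: "(real^2) set \<Rightarrow> bool" where
  "groeger_regular G \<longleftrightarrow>
     bounded G \<and>
     (\<forall>x\<in>frontier G. \<exists>U (\<Phi> :: real^2 \<Rightarrow> real^2).
        open U \<and> x \<in> U \<and> inj_on \<Phi> U \<and>
        (\<exists>L. L-lipschitz_on U \<Phi>) \<and> (\<exists>L. L-lipschitz_on (\<Phi> ` U) (inv_into U \<Phi>)) \<and>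
        \<Phi> ` (U \<inter> G) \<in> {groeger_E1, groeger_E2, groeger_E3})"


section \<open>Function spaces on the time interval\<close>

definition L2_time ::
    "real \<Rightarrow> 'v::{banach, second_countable_topology} set \<Rightarrow> (real, 'v) L2 set" where
  "L2_time T V = {f \<in> L2_on {0..T}. AE t in lborel. t \<in> {0..T} \<longrightarrow> rep_L2 f t \<in> V}"

text \<open>
  As in space, an element of \<open>H\<^sup>1(I, V)\<close> is represented by the pair of the function and its weak
  time derivative, and the norm is the inherited one. The integrals in \<open>weak_partial\<close> are Bochner
  integrals in the ambient space of \<open>V\<close>.
\<close>

definition H1_time ::
    "real \<Rightarrow> 'v::{banach, second_countable_topology} set \<Rightarrow> ((real, 'v) L2 \<times> (real, 'v) L2) set" where
  "H1_time T V =
     {(f, f'). f \<in> L2_time T V \<and> f' \<in> L2_time T V \<and>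
        weak_partial {0<..<T} 1 (rep_L2 f) (rep_L2 f')}"

text \<open>The value at \<open>0\<close> of the continuous representative on \<open>[0, T]\<close>.\<close>

definition initial_value :: "real \<Rightarrow> (real, 'v::{banach, second_countable_topology}) L2 \<Rightarrow> 'v" where
  "initial_value T f =
     (THE v. \<exists>c. continuous_on {0..T} c \<and>
        (AE t in lborel. t \<in> {0..T} \<longrightarrow> rep_L2 f t = c t) \<and> c 0 = v)"

type_synonym state = "(real, h1_vector) L2 \<times> (real, h2_scalar) L2 \<times> (real, h2_scalar) L2"

definition space_Y :: "(real^2) set \<Rightarrow> (real^2) set \<Rightarrow> real \<Rightarrow> state set" where
  "space_Y \<Omega> \<Gamma>\<^sub>D T = L2_time T (V_u \<Omega> \<Gamma>\<^sub>D) \<times> H1_time T (V_phi \<Omega>)"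

definition space_Z :: "(real^2) set \<Rightarrow> real \<Rightarrow> (h2_scalar \<times> (real, h2_scalar) L2) set" where
  "space_Z \<Omega> T = V_phi \<Omega> \<times> L2_time T (V_phi \<Omega>)"

definition cone_K2 :: "(real^2) set \<Rightarrow> real \<Rightarrow> (real, h2_scalar) L2 set" where
  "cone_K2 \<Omega> T =
     {z \<in> L2_time T (V_phi \<Omega>).
        AE t in lborel. t \<in> {0..T} \<longrightarrow>
          (AE x in lborel. x \<in> \<Omega> \<longrightarrow> 0 \<le> rep_L2 (fst (rep_L2 z t)) x)}"

definition cone_K :: "(real^2) set \<Rightarrow> real \<Rightarrow> (h2_scalar \<times> (real, h2_scalar) L2) set" where
  "cone_K \<Omega> T = {0} \<times> cone_K2 \<Omega> T"

text \<open>A state \<open>(u, \<phi>, \<phi>')\<close> carries the time derivative \<open>\<phi>'\<close> of \<open>\<phi>\<close>.\<close>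

definition constraint_map ::
    "real \<Rightarrow> h2_scalar \<Rightarrow> state \<Rightarrow> h2_scalar \<times> (real, h2_scalar) L2" where
  "constraint_map T \<phi>\<^sub>0 = (\<lambda>(u, \<phi>, \<phi>'). (initial_value T \<phi> - \<phi>\<^sub>0, - \<phi>'))"

definition feasible_set :: "(real^2) set \<Rightarrow> (real^2) set \<Rightarrow> real \<Rightarrow> h2_scalar \<Rightarrow> state set" where
  "feasible_set \<Omega> \<Gamma>\<^sub>D T \<phi>\<^sub>0 = {y \<in> space_Y \<Omega> \<Gamma>\<^sub>D T. constraint_map T \<phi>\<^sub>0 y \<in> cone_K \<Omega> T}"

end

theory Submission
  imports Defs
begin

text \<open>
  A state's phase field satisfies \<open>\<phi> t = \<phi> 0 + \<integral>\<^sub>0\<^sup>t \<phi>'\<close> almost everywhere, by the lemma of du Bois-Reymond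
  for Bochner integrals. Hence \<open>\<phi> 0\<close> is a bounded linear function of \<open>(\<phi>, \<phi>')\<close>, so that \<open>g\<close> is affine
  with a bounded linear part \<open>g'\<close>. A preimage of \<open>(a, z)\<close> under \<open>g'\<close> is \<open>(0, \<phi>)\<close> with
  \<open>\<phi> t = a - \<integral>\<^sub>0\<^sup>t z\<close>.
\<close>

section \<open>Duality in \<open>L2\<close>\<close>

text \<open>The obstacle is that all spaces are subsets of ambient product types.
  \<open>has_derivative\<close> demands a bounded linear map on the whole type \<open>state\<close>,
  whereas \<open>initial_value\<close> is a definite description, meaningful only when a continuous
  representative exists. So \<open>g'\<close> needs an integral formula for the value at 0 that
  agrees with \<open>initial_value\<close> on \<open>space_Y\<close>. Moreover, Bochner integrals
  are formed in the ambient space, so both the initial value of a given state and the primitive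
  built for surjectivity must be shown to lie in \<open>V_phi \<Omega>\<close>. Weak time
  derivatives are tested only with scalar smooth functions whose compact support lies in the open
  interval, even for vector-valued functions; explicit bumps supply enough of them. Integration by
  parts rests on Fubini's theorem and never differentiates a vector-valued primitive
  pointwise.\<close>

lemma rep_L2_add: "AE x in lborel. rep_L2 (f + g) x = rep_L2 f x + rep_L2 g x"
  using rep_abs_L2[of "\<lambda>x. rep_L2 f x + rep_L2 g x"] abs_L2_add[of "rep_L2 f" "rep_L2 g"]
  by (simp add: square_integrable_add)

lemma rep_L2_scaleR: "AE x in lborel. rep_L2 (c *\<^sub>R f) x = c *\<^sub>R rep_L2 f x"
  using rep_abs_L2[of "\<lambda>x. c *\<^sub>R rep_L2 f x"] scaleR_L2.abs_eq[of "rep_L2 f" c]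
  by (simp add: square_integrable_scaleR l2_equal_def)

lemma rep_L2_uminus: "AE x in lborel. rep_L2 (- f) x = - rep_L2 f x"
  using rep_L2_scaleR[of "-1" f] by simp

lemma rep_L2_zero: "AE x in lborel. rep_L2 0 x = 0"
  using rep_abs_L2[of "\<lambda>x. 0"] by (simp add: zero_L2_def map_fun_def)

lemma abs_L2_eq_iff:
  "square_integrable f \<Longrightarrow> square_integrable g \<Longrightarrow>
     abs_L2 f = abs_L2 g \<longleftrightarrow> (AE x in lborel. f x = g x)"
  using Quotient_rel[OF Quotient_L2, of f g] by (simp add: l2_equal_def)

lemma norm_L2_eq: "norm f = l2_norm (rep_L2 f)"
  using norm_abs_L2[OF square_integrable_rep, of f] by simp

text \<open>The pointwise bound \<open>a * b \<le> a\<^sup>2 + b\<^sup>2\<close> gives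
  integrability. The estimate is the Cauchy-Schwarz inequality for the norms, as \<open>f\<close>
  takes values in a Banach space without inner product.\<close>

lemma integrable_pairing:
  assumes h: "square_integrable h" and f: "square_integrable f"
  shows "integrable lborel (\<lambda>x. h x *\<^sub>R f x)"
    and "norm (LINT x|lborel. h x *\<^sub>R f x) \<le> l2_norm h * l2_norm f"
proof -
  note [measurable] = h[THEN square_integrable_measurable] f[THEN square_integrable_measurable]
  have Ih: "integrable lborel (\<lambda>x. (norm (h x))\<^sup>2)" and If: "integrable lborel (\<lambda>x. (norm (f x))\<^sup>2)"
    using h f by (auto simp: square_integrable_def)
  show int: "integrable lborel (\<lambda>x. h x *\<^sub>R f x)"
  proof (rule Bochner_Integration.integrable_bound)
    show "integrable lborel (\<lambda>x. (norm (h x))\<^sup>2 + (norm (f x))\<^sup>2)" using Ih If by simp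
    have "norm (h x) * norm (f x) \<le> (norm (h x))\<^sup>2 + (norm (f x))\<^sup>2" for x
      using sum_squares_bound[of "norm (h x)" "norm (f x)"]
        mult_nonneg_nonneg[OF norm_ge_zero[of "h x"] norm_ge_zero[of "f x"]]
      by linarith
    then show "AE x in lborel. norm (h x *\<^sub>R f x) \<le> norm ((norm (h x))\<^sup>2 + (norm (f x))\<^sup>2)"
      by simp
  qed measurable
  let ?C = "LINT x|lborel. norm (h x *\<^sub>R f x)"
  have "(\<integral>\<^sup>+x. ennreal (norm (h x)) * ennreal (norm (f x)) \<partial>lborel)\<^sup>2
      \<le> (\<integral>\<^sup>+x. (ennreal (norm (h x)))\<^sup>2 \<partial>lborel) * (\<integral>\<^sup>+x. (ennreal (norm (f x)))\<^sup>2 \<partial>lborel)"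
    by (rule Cauchy_Schwarz_nn_integral) measurable
  also have "\<dots> = ennreal ((l2_norm h * l2_norm f)\<^sup>2)"
    using Ih If by (simp add: ennreal_power nn_integral_eq_integral ennreal_mult l2_norm_def
        power_mult_distrib)
  also have "(\<integral>\<^sup>+x. ennreal (norm (h x)) * ennreal (norm (f x)) \<partial>lborel) = ennreal ?C"
    using integrable_norm[OF int] by (simp add: nn_integral_eq_integral flip: ennreal_mult)
  finally have "?C\<^sup>2 \<le> (l2_norm h * l2_norm f)\<^sup>2"
    by (simp add: ennreal_power ennreal_le_iff)
  then have "?C \<le> l2_norm h * l2_norm f"
    by (rule power2_le_imp_le) (simp add: l2_norm_def)
  then show "norm (LINT x|lborel. h x *\<^sub>R f x) \<le> l2_norm h * l2_norm f"
    using integral_norm_bound[of lborel "\<lambda>x. h x *\<^sub>R f x"] by linarith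
qed

text \<open>Weak derivatives in space and the trace at time 0 are both assembled from such maps, so
  this is the source of their continuity.\<close>

lemma bounded_linear_pairing:
  fixes h :: "'a::euclidean_space \<Rightarrow> real"
  assumes h: "square_integrable h"
  shows "bounded_linear
    (\<lambda>f :: ('a, 'b::{banach, second_countable_topology}) L2. LINT x|lborel. h x *\<^sub>R rep_L2 f x)"
proof (rule bounded_linear_intro[where K = "l2_norm h"])
  note [measurable] = h[THEN square_integrable_measurable]
  have int: "integrable lborel (\<lambda>x. h x *\<^sub>R rep_L2 f x)" for f :: "('a, 'b) L2"
    by (rule integrable_pairing(1)[OF h square_integrable_rep])
  fix f g :: "('a, 'b) L2" and c :: real
  \<comment> \<open>\<open>rep_L2\<close> picks representatives and is additive only almost
    everywhere, which suffices under the integral.\<close>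
  have "(LINT x|lborel. h x *\<^sub>R rep_L2 (f + g) x)
      = (LINT x|lborel. h x *\<^sub>R rep_L2 f x + h x *\<^sub>R rep_L2 g x)"
    by (rule integral_cong_AE, measurable, use rep_L2_add[of f g] in eventually_elim)
      (simp add: scaleR_add_right)
  then show "(LINT x|lborel. h x *\<^sub>R rep_L2 (f + g) x)
      = (LINT x|lborel. h x *\<^sub>R rep_L2 f x) + (LINT x|lborel. h x *\<^sub>R rep_L2 g x)"
    using int by simp
  have "(LINT x|lborel. h x *\<^sub>R rep_L2 (c *\<^sub>R f) x) = (LINT x|lborel. c *\<^sub>R (h x *\<^sub>R rep_L2 f x))"
    by (rule integral_cong_AE, measurable, use rep_L2_scaleR[of c f] in eventually_elim) simp
  then show "(LINT x|lborel. h x *\<^sub>R rep_L2 (c *\<^sub>R f) x) = c *\<^sub>R (LINT x|lborel. h x *\<^sub>R rep_L2 f x)"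
    by (simp only: integral_scaleR_right)
  show "norm (LINT x|lborel. h x *\<^sub>R rep_L2 f x) \<le> norm f * l2_norm h"
    using integrable_pairing(2)[OF h square_integrable_rep[of f]]
    by (simp add: norm_L2_eq mult.commute)
qed

text \<open>Turns the support condition of \<open>L2_on\<close>, stated for representatives, into
  the kernel of a bounded linear operator.\<close>

definition cutoff :: "'a set \<Rightarrow> ('a::euclidean_space, 'b::{banach, second_countable_topology}) L2 \<Rightarrow> ('a, 'b) L2" where
  "cutoff A f = abs_L2 (\<lambda>x. indicator A x *\<^sub>R rep_L2 f x)"

lemma square_integrable_indicator_scaleR:
  assumes "square_integrable f" "A \<in> sets borel"
  shows "square_integrable (\<lambda>x. indicator A x *\<^sub>R f x)"
proof (rule square_integrable_dominated)
  show "integrable lborel (\<lambda>x. (norm (f x))\<^sup>2)"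
    using assms by (simp add: square_integrable_def)
  show "(\<lambda>x. indicator A x *\<^sub>R f x) \<in> borel_measurable lborel"
    using assms by (auto simp: square_integrable_def intro!: borel_measurable_scaleR)
qed (auto simp: indicator_scaleR_norm_sq split: split_indicator)

lemma bounded_linear_cutoff:
  assumes [measurable]: "A \<in> sets borel"
  shows "bounded_linear
    (cutoff A :: ('a::euclidean_space, 'b::{banach, second_countable_topology}) L2 \<Rightarrow> _)"
proof (rule bounded_linear_intro[where K = 1])
  have sq: "square_integrable (\<lambda>x. indicator A x *\<^sub>R rep_L2 f x)" for f :: "('a, 'b) L2"
    by (rule square_integrable_indicator_scaleR[OF square_integrable_rep assms])
  fix f g :: "('a, 'b) L2" and c :: real
  have "AE x in lborel. indicator A x *\<^sub>R rep_L2 (f + g) x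
      = indicator A x *\<^sub>R rep_L2 f x + indicator A x *\<^sub>R rep_L2 g x"
    using rep_L2_add[of f g] by eventually_elim (simp add: scaleR_add_right)
  then show "cutoff A (f + g) = cutoff A f + cutoff A g"
    unfolding cutoff_def by (simp add: abs_L2_add abs_L2_eq_iff square_integrable_add sq)
  have "AE x in lborel. indicator A x *\<^sub>R rep_L2 (c *\<^sub>R f) x = c *\<^sub>R (indicator A x *\<^sub>R rep_L2 f x)"
    using rep_L2_scaleR[of c f] by eventually_elim simp
  then have "cutoff A (c *\<^sub>R f) = abs_L2 (\<lambda>x. c *\<^sub>R (indicator A x *\<^sub>R rep_L2 f x))"
    unfolding cutoff_def
    by (subst abs_L2_eq_iff) (rule sq, rule square_integrable_scaleR[OF sq], simp)
  also have "\<dots> = c *\<^sub>R cutoff A f"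
    unfolding cutoff_def by (rule scaleR_L2.abs_eq[symmetric]) (simp add: l2_equal_def sq)
  finally show "cutoff A (c *\<^sub>R f) = c *\<^sub>R cutoff A f" .
  have "l2_norm (\<lambda>x. indicator A x *\<^sub>R rep_L2 f x) \<le> l2_norm (rep_L2 f)"
    unfolding l2_norm_def
    using sq[of f] square_integrable_rep[of f]
    by (intro real_sqrt_le_mono integral_mono)
      (auto simp: square_integrable_def indicator_scaleR_norm_sq split: split_indicator)
  then show "norm (cutoff A f) \<le> norm f * 1"
    unfolding cutoff_def norm_abs_L2[OF sq] norm_L2_eq[of f] by simp
qed

lemma L2_on_eq_kernel:
  assumes "U \<in> sets borel"
  shows "L2_on U = {f. cutoff (- U) f = 0}"
proof -
  have "cutoff (- U) f = 0 \<longleftrightarrow> f \<in> L2_on U" for f :: "('a, 'b) L2"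
  proof -
    have "cutoff (- U) f = 0 \<longleftrightarrow> cutoff (- U) f = abs_L2 (\<lambda>x. 0)"
      by (simp add: zero_L2_def map_fun_def)
    also have "\<dots> \<longleftrightarrow> (AE x in lborel. indicator (- U) x *\<^sub>R rep_L2 f x = 0)"
      unfolding cutoff_def using assms
      by (intro abs_L2_eq_iff square_integrable_indicator_scaleR) auto
    finally show ?thesis by (simp add: L2_on_def indicator_def imp_conv_disj)
  qed
  then show ?thesis by blast
qed

section \<open>Sobolev spaces as kernels\<close>

text \<open>That a Bochner integral stays in a closed subspace is usually derived from Hahn--Banach. The
  Sobolev spaces are common kernels of bounded linear maps, and there it is immediate.\<close>

definition integral_closed :: "'v::{banach, second_countable_topology} set \<Rightarrow> bool" where
  "integral_closed V \<longleftrightarrow> subspace V \<and>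
     (\<forall>f. integrable (lborel :: real measure) f \<longrightarrow> (AE t in lborel. f t \<in> V) \<longrightarrow>
        integral\<^sup>L lborel f \<in> V)"

lemma integral_closedD:
  assumes "integral_closed V"
  shows "subspace V"
    and "integrable (lborel :: real measure) f \<Longrightarrow> AE t in lborel. f t \<in> V \<Longrightarrow>
      integral\<^sup>L lborel f \<in> V"
  using assms by (auto simp: integral_closed_def)

text \<open>Bounded linear maps commute with the Bochner integral, and the composition of
  \<open>L\<close> with \<open>f\<close> vanishes almost everywhere.\<close>

lemma integral_closed_kernel:
  fixes L :: "'v::{banach, second_countable_topology} \<Rightarrow> 'w::{banach, second_countable_topology}"
  assumes L: "bounded_linear L"
  shows "integral_closed {v. L v = 0}"
proof -
  interpret L: bounded_linear L by (fact L)
  have "L (integral\<^sup>L lborel f) = 0"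
    if f: "integrable (lborel :: real measure) f" and z: "AE t in lborel. L (f t) = 0" for f
  proof -
    have "L (integral\<^sup>L lborel f) = (LINT t|lborel. L (f t))"
      using integral_bounded_linear[OF L f] by simp
    also have "\<dots> = 0" by (rule integral_eq_zero_AE[OF z])
    finally show ?thesis .
  qed
  then show ?thesis
    by (simp add: integral_closed_def subspace_def L.zero L.add L.scaleR)
qed

text \<open>The family may be uncountable, as it is for conditions indexed by test functions: the
  integral is tested against one \<open>V\<close> at a time.\<close>

lemma integral_closed_Inter:
  assumes "\<And>V. V \<in> \<V> \<Longrightarrow> integral_closed V"
  shows "integral_closed (\<Inter>\<V>)"
  unfolding integral_closed_def
proof (intro conjI allI impI InterI)
  show "subspace (\<Inter>\<V>)" using assms by (intro subspace_Inter) (auto dest: integral_closedD)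
  fix f :: "real \<Rightarrow> 'a" and V
  assume f: "integrable lborel f" "AE t in lborel. f t \<in> \<Inter>\<V>" and V: "V \<in> \<V>"
  have "AE t in lborel. f t \<in> V" using f(2) by eventually_elim (use V in auto)
  then show "integral\<^sup>L lborel f \<in> V" by (rule integral_closedD(2)[OF assms[OF V] f(1)])
qed

lemma integral_closed_Int:
  "integral_closed V \<Longrightarrow> integral_closed W \<Longrightarrow> integral_closed (V \<inter> W)"
  using integral_closed_Inter[of "{V, W}"] by auto

lemma integral_closed_vimage:
  fixes L :: "'v::{banach, second_countable_topology} \<Rightarrow> 'w::{banach, second_countable_topology}"
  assumes L: "bounded_linear L" and V: "integral_closed V"
  shows "integral_closed (L -` V)"
  unfolding integral_closed_def
proof (intro conjI allI impI)
  interpret L: bounded_linear L by (fact L)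
  show "subspace (L -` V)"
    using integral_closedD(1)[OF V] by (simp add: subspace_def L.zero L.add L.scaleR)
  fix f :: "real \<Rightarrow> 'v"
  assume f: "integrable lborel f" "AE t in lborel. f t \<in> L -` V"
  have "(LINT t|lborel. L (f t)) \<in> V"
    using f by (intro integral_closedD(2)[OF V] integrable_bounded_linear[OF L]) auto
  then show "integral\<^sup>L lborel f \<in> L -` V"
    using integral_bounded_linear[OF L f(1)] by simp
qed

section \<open>Test functions: supports and integrability\<close>

lemma frechet_derivative_support:
  "frechet_derivative \<eta> (at x) v \<noteq> 0 \<Longrightarrow> x \<in> closure {x. \<eta> x \<noteq> 0}"
proof (rule ccontr)
  assume nz: "frechet_derivative \<eta> (at x) v \<noteq> 0" and x: "x \<notin> closure {x. \<eta> x \<noteq> 0}"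
  have "(\<eta> has_derivative (\<lambda>_. 0)) (at x)"
  proof (rule has_derivative_transform_within_open[OF has_derivative_const])
    show "open (- closure {x. \<eta> x \<noteq> 0})" "x \<in> - closure {x. \<eta> x \<noteq> 0}" using x by auto
    show "0 = \<eta> y" if "y \<in> - closure {x. \<eta> x \<noteq> 0}" for y
      using that closure_subset[of "{x. \<eta> x \<noteq> 0}"] by auto
  qed
  then have "frechet_derivative \<eta> (at x) = (\<lambda>_. 0)"
    by (rule frechet_derivative_at[symmetric])
  with nz show False by simp
qed

lemma square_integrable_compact_support:
  fixes f :: "'a::euclidean_space \<Rightarrow> 'b::{banach, second_countable_topology}"
  assumes f: "continuous_on UNIV f" and K: "compact K" and fK: "\<And>x. f x \<noteq> 0 \<Longrightarrow> x \<in> K"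
  shows "square_integrable f" and "integrable lborel f"
proof -
  have "integrable lborel (\<lambda>x. indicator K x *\<^sub>R f x)"
    by (intro borel_integrable_compact K continuous_on_subset[OF f]) auto
  also have "(\<lambda>x. indicator K x *\<^sub>R f x) = f"
    using fK by (intro ext) (auto split: split_indicator)
  finally show "integrable lborel f" .
  have "integrable lborel (\<lambda>x. indicator K x *\<^sub>R (norm (f x))\<^sup>2)"
    by (intro borel_integrable_compact K continuous_intros continuous_on_subset[OF f]) auto
  also have "(\<lambda>x. indicator K x *\<^sub>R (norm (f x))\<^sup>2) = (\<lambda>x. (norm (f x))\<^sup>2)"
    using fK by (intro ext) (auto split: split_indicator)
  finally show "square_integrable f"
    using borel_measurable_continuous_onI[OF f] by (simp add: square_integrable_def)
qed

lemma test_functionsD: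
  assumes "\<eta> \<in> test_functions U"
  shows "compact (closure {x. \<eta> x \<noteq> 0})" "closure {x. \<eta> x \<noteq> 0} \<subseteq> U"
    and "\<eta> differentiable (at x)" and "continuous_on UNIV (\<lambda>x. frechet_derivative \<eta> (at x) v)"
    and "square_integrable \<eta>" and "square_integrable (\<lambda>x. frechet_derivative \<eta> (at x) v)"
    and "integrable lborel (\<lambda>x. frechet_derivative \<eta> (at x) v)"
proof -
  show *: "compact (closure {x. \<eta> x \<noteq> 0})" "closure {x. \<eta> x \<noteq> 0} \<subseteq> U"
    using assms by (auto simp: test_functions_def)
  have C: "C_k k \<eta>" for k
    using assms by (auto simp: test_functions_def C_infinity_def)
  show "\<eta> differentiable (at x)" using C[of "Suc 0"] by simp
  have c: "continuous_on UNIV \<eta>" using C[of 0] by simp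
  show c': "continuous_on UNIV (\<lambda>x. frechet_derivative \<eta> (at x) v)"
    using C_k.simps(2)[THEN iffD1, OF C[of "Suc 0"], THEN conjunct2, THEN spec, of v]
    unfolding C_k.simps(1) .
  have supp: "y \<in> closure {x. \<eta> x \<noteq> 0}" if "\<eta> y \<noteq> 0" for y
    using that by (intro subsetD[OF closure_subset]) simp
  show "square_integrable \<eta>"
    by (rule square_integrable_compact_support[OF c *(1) supp])
  show "square_integrable (\<lambda>x. frechet_derivative \<eta> (at x) v)"
    "integrable lborel (\<lambda>x. frechet_derivative \<eta> (at x) v)"
    by (rule square_integrable_compact_support[OF c' *(1)], erule frechet_derivative_support)+
qed

lemma integral_closed_sobolev_H1:
  assumes U: "U \<in> sets borel"
  shows "integral_closed (sobolev_H1 U :: ((real^2, 'b::euclidean_space) L2 \<times> (real^2, 'b^2) L2) set)"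
proof -
  \<comment> \<open>\<open>P i \<eta> = 0\<close> is the weak derivative identity in direction
    \<open>i\<close> tested with \<open>\<eta>\<close>. The component is taken after integration, so
    that the vector-valued pairing bound applies to \<open>G\<close>.\<close>
  define P :: "2 \<Rightarrow> (real^2 \<Rightarrow> real) \<Rightarrow> (real^2, 'b) L2 \<times> (real^2, 'b^2) L2 \<Rightarrow> 'b" where
    "P i \<eta> = (\<lambda>(f, G). (LINT x|lborel. frechet_derivative \<eta> (at x) (axis i 1) *\<^sub>R rep_L2 f x)
        + (LINT x|lborel. \<eta> x *\<^sub>R rep_L2 G x) $ i)" for i \<eta>
  have P: "bounded_linear (P i \<eta>)" if "\<eta> \<in> test_functions U" for i \<eta>
  proof -
    note blp = bounded_linear_pairing[OF test_functionsD(5)[OF that]]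
      bounded_linear_pairing[OF test_functionsD(6)[OF that]]
    show ?thesis
      unfolding P_def case_prod_beta
      by (intro bounded_linear_add
          bounded_linear_compose[OF blp(2) bounded_linear_fst]
          bounded_linear_compose[OF bounded_linear_vec_nth bounded_linear_compose[OF blp(1) bounded_linear_snd]])
  qed
  have wg: "weak_gradient U f G \<longleftrightarrow> (\<forall>i. \<forall>\<eta>\<in>test_functions U. P i \<eta> (f, G) = 0)"
    for f :: "(real^2, 'b) L2" and G
  proof -
    have "(LINT x|lborel. \<eta> x *\<^sub>R rep_L2 G x) $ i = (LINT x|lborel. \<eta> x *\<^sub>R rep_L2 G x $ i)"
      if "\<eta> \<in> test_functions U" for \<eta> i
      using integral_bounded_linear[OF bounded_linear_vec_nth
          integrable_pairing(1)[OF test_functionsD(5)[OF that] square_integrable_rep[of G]], of i]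
      by simp
    then show ?thesis
      by (simp add: weak_gradient_def weak_partial_def P_def add_eq_0_iff2 cong: ball_cong)
  qed
  have "sobolev_H1 U = (fst -` L2_on U) \<inter> (snd -` L2_on U) \<inter>
      \<Inter> ((\<lambda>(i, \<eta>). {v. P i \<eta> v = 0}) ` (UNIV \<times> test_functions U))"
    by (auto simp: sobolev_H1_def wg)
  also have "integral_closed \<dots>"
    unfolding L2_on_eq_kernel[OF U]
    using U by (intro integral_closed_Int integral_closed_Inter integral_closed_vimage
        bounded_linear_fst bounded_linear_snd)
      (auto intro!: integral_closed_kernel bounded_linear_cutoff P)
  finally show ?thesis .
qed

lemma integral_closed_sobolev_H2:
  assumes "U \<in> sets borel"
  shows "integral_closed (sobolev_H2 U)"
proof -
  have "sobolev_H2 U = ((\<lambda>v. (fst v, fst (snd v))) -` sobolev_H1 U) \<inter> (snd -` sobolev_H1 U)"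
    by (auto simp: sobolev_H2_def)
  also have "integral_closed \<dots>"
    using assms by (intro integral_closed_Int integral_closed_vimage integral_closed_sobolev_H1
        bounded_linear_Pair bounded_linear_fst bounded_linear_snd
        bounded_linear_compose[OF bounded_linear_fst bounded_linear_snd])
  finally show ?thesis .
qed

section \<open>Smooth functions of one variable\<close>

lemma frechet_derivative_real:
  "(f has_real_derivative D) (at x) \<Longrightarrow> frechet_derivative f (at x) v = D * v"
  using frechet_derivative_at[of f "(*) D" x] by (simp add: has_field_derivative_def)

lemma has_real_derivative_frechet:
  fixes f :: "real \<Rightarrow> real"
  assumes "f differentiable (at x)"
  shows "(f has_real_derivative frechet_derivative f (at x) 1) (at x)"
proof -
  from assms obtain D where D: "(f has_real_derivative D) (at x)"
    by (auto simp: real_differentiable_def)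
  with frechet_derivative_real[OF D, of 1] show ?thesis by simp
qed

lemma C_k_zero: "C_k k (\<lambda>x. 0)"
  by (induction k) (auto simp: frechet_derivative_const)

text \<open>Proved straight from directional derivatives, because the description of
  \<open>C_k\<close> by a single derivative below already relies on it.\<close>

lemma C_k_cmult:
  fixes f :: "real \<Rightarrow> real"
  shows "C_k k f \<Longrightarrow> C_k k (\<lambda>x. c * f x)"
proof (induction k arbitrary: f)
  case 0
  then show ?case by (auto intro!: continuous_intros)
next
  case (Suc k)
  then have f: "f differentiable (at x)" "C_k k (\<lambda>x. frechet_derivative f (at x) v)" for x v
    unfolding C_k.simps by blast+
  have d: "((\<lambda>x. c * f x) has_real_derivative c * frechet_derivative f (at x) 1) (at x)" for x
    by (rule DERIV_cmult[OF has_real_derivative_frechet[OF f(1)]])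
  have "frechet_derivative (\<lambda>x. c * f x) (at x) v = c * frechet_derivative f (at x) v" for x v
    unfolding frechet_derivative_real[OF d]
      frechet_derivative_real[OF has_real_derivative_frechet[OF f(1)], of x v] by simp
  then have "C_k k (\<lambda>x. frechet_derivative (\<lambda>x. c * f x) (at x) v)" for v
    using Suc.IH[OF f(2)] by presburger
  moreover have "(\<lambda>x. c * f x) differentiable (at x)" for x
    using d by (auto simp: real_differentiable_def)
  ultimately show ?case unfolding C_k.simps by blast
qed

text \<open>On the line the derivative in direction \<open>v\<close> is \<open>v\<close> times the
  one in direction 1, so the quantifier over directions collapses and later inductions handle a
  single derivative.\<close>

lemma C_k_Suc_iff:
  fixes f :: "real \<Rightarrow> real"
  shows "C_k (Suc k) f \<longleftrightarrow> (\<exists>f'. (\<forall>x. (f has_real_derivative f' x) (at x)) \<and> C_k k f')"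
proof
  assume "C_k (Suc k) f"
  then have f: "f differentiable (at x)" "C_k k (\<lambda>x. frechet_derivative f (at x) 1)" for x
    unfolding C_k.simps by blast+
  show "\<exists>f'. (\<forall>x. (f has_real_derivative f' x) (at x)) \<and> C_k k f'"
    by (intro exI[of _ "\<lambda>x. frechet_derivative f (at x) 1"] conjI allI
        has_real_derivative_frechet f)
next
  assume "\<exists>f'. (\<forall>x. (f has_real_derivative f' x) (at x)) \<and> C_k k f'"
  then obtain f' where f': "\<And>x. (f has_real_derivative f' x) (at x)" "C_k k f'" by blast
  have "f differentiable (at x)" for x
    using f'(1) by (auto simp: real_differentiable_def)
  moreover have "C_k k (\<lambda>x. frechet_derivative f (at x) v)" for v
    using C_k_cmult[OF f'(2), of v] by (simp add: frechet_derivative_real[OF f'(1)] mult.commute)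
  ultimately show "C_k (Suc k) f" unfolding C_k.simps by blast
qed

lemma DERIV_continuous_on_UNIV:
  "(\<And>x. (f has_real_derivative f' x) (at x)) \<Longrightarrow> continuous_on UNIV f"
  by (auto simp: continuous_on_eq_continuous_at intro: DERIV_isCont)

lemma C_k_lower:
  fixes f :: "real \<Rightarrow> real"
  shows "C_k (Suc k) f \<Longrightarrow> C_k k f"
proof (induction k arbitrary: f)
  case 0
  then show ?case
    unfolding C_k_Suc_iff by (auto intro: DERIV_continuous_on_UNIV)
next
  case (Suc k)
  then show ?case by (metis C_k_Suc_iff)
qed

lemma C_k_add:
  fixes f g :: "real \<Rightarrow> real"
  shows "C_k k f \<Longrightarrow> C_k k g \<Longrightarrow> C_k k (\<lambda>x. f x + g x)"
proof (induction k arbitrary: f g)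
  case 0
  then show ?case by (auto intro!: continuous_intros)
next
  case (Suc k)
  then obtain f' g' where "\<And>x. (f has_real_derivative f' x) (at x)" "C_k k f'"
    "\<And>x. (g has_real_derivative g' x) (at x)" "C_k k g'"
    unfolding C_k_Suc_iff by blast
  then show ?case
    unfolding C_k_Suc_iff
    by (intro exI[of _ "\<lambda>x. f' x + g' x"] conjI allI DERIV_add Suc.IH)
qed

lemma C_k_mult:
  fixes f g :: "real \<Rightarrow> real"
  shows "C_k k f \<Longrightarrow> C_k k g \<Longrightarrow> C_k k (\<lambda>x. f x * g x)"
proof (induction k arbitrary: f g)
  case 0
  then show ?case by (auto intro!: continuous_intros)
next
  case (Suc k)
  from Suc.prems obtain f' g' where d: "\<And>x. (f has_real_derivative f' x) (at x)" "C_k k f'"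
    "\<And>x. (g has_real_derivative g' x) (at x)" "C_k k g'"
    unfolding C_k_Suc_iff by blast
  \<comment> \<open>The product rule pairs each derivative with the other factor undifferentiated,
    which has to be lowered from order \<open>Suc k\<close> to \<open>k\<close>.\<close>
  have "C_k k (\<lambda>x. f' x * g x + g' x * f x)"
    by (rule C_k_add[OF Suc.IH[OF d(2) C_k_lower[OF Suc.prems(2)]]
          Suc.IH[OF d(4) C_k_lower[OF Suc.prems(1)]]])
  then show ?case
    unfolding C_k_Suc_iff
    by (intro exI[of _ "\<lambda>x. f' x * g x + g' x * f x"] conjI allI DERIV_mult d)
qed

lemma C_k_affine:
  fixes f :: "real \<Rightarrow> real"
  shows "C_k k f \<Longrightarrow> C_k k (\<lambda>x. f (a * x + b))"
proof (induction k arbitrary: f)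
  case 0
  then show ?case
    by (auto intro!: continuous_on_compose2[of UNIV f] continuous_intros)
next
  case (Suc k)
  then obtain f' where d: "\<And>x. (f has_real_derivative f' x) (at x)" "C_k k f'"
    unfolding C_k_Suc_iff by blast
  have "((\<lambda>x. f (a * x + b)) has_real_derivative a * f' (a * x + b)) (at x)" for x
  proof -
    have "((\<lambda>x. a * x + b) has_real_derivative a) (at x)"
      by (auto intro!: derivative_eq_intros)
    from DERIV_chain2[where g = "\<lambda>x. a * x + b", OF d(1) this] show ?thesis
      by (simp add: mult.commute)
  qed
  then show ?case
    unfolding C_k_Suc_iff
    by (intro exI[of _ "\<lambda>x. a * f' (a * x + b)"] conjI allI C_k_cmult[OF Suc.IH[OF d(2)]])
qed

section \<open>Smooth bumps built from \<open>exp (- 1 / x)\<close>\<close>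

definition flat_exp :: "nat \<Rightarrow> real \<Rightarrow> real" where
  "flat_exp n x = (if x \<le> 0 then 0 else exp (- inverse x) / x ^ n)"

lemma flat_exp_tendsto_0: "(flat_exp n \<longlongrightarrow> 0) (at 0)"
proof (rule filterlim_split_at)
  show "(flat_exp n \<longlongrightarrow> 0) (at_left 0)"
    by (rule tendsto_eventually) (auto simp: flat_exp_def eventually_at_filter)
  \<comment> \<open>The substitution \<open>1 / x\<close> turns the right-hand limit at 0 into the
    decay of \<open>x ^ n / exp x\<close> at infinity.\<close>
  have "\<forall>\<^sub>F x in at_top. x ^ n / exp x = flat_exp n (inverse x)"
    using eventually_gt_at_top[of 0]
    by eventually_elim (simp add: flat_exp_def exp_minus field_simps)
  from Lim_transform_eventually[OF tendsto_power_div_exp_0 this]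
  show "(flat_exp n \<longlongrightarrow> 0) (at_right 0)"
    by (simp add: filterlim_at_right_to_top)
qed

text \<open>The powers in the denominator of \<open>flat_exp\<close> keep derivatives within the
  span of the family, so smoothness follows by one induction for all \<open>n\<close> at
  once.\<close>

lemma has_real_derivative_flat_exp:
  "(flat_exp n has_real_derivative flat_exp (n + 2) x + - real n * flat_exp (n + 1) x) (at x)"
proof (cases x "0 :: real" rule: linorder_cases)
  case less
  have "(flat_exp n has_real_derivative 0) (at x)"
    by (rule has_field_derivative_transform_within_open[of "\<lambda>_. 0" _ _ "{..<0}"])
      (use less in \<open>auto simp: flat_exp_def\<close>)
  then show ?thesis using less by (simp add: flat_exp_def)
next
  case equal
  \<comment> \<open>The difference quotient at 0 is \<open>flat_exp (Suc n)\<close> itself.\<close>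
  have "((\<lambda>h. (flat_exp n (0 + h) - flat_exp n 0) / h) \<longlongrightarrow> 0) (at 0)"
    by (rule Lim_transform_eventually[OF flat_exp_tendsto_0[of "Suc n"]])
      (auto simp: flat_exp_def eventually_at_filter)
  then show ?thesis using equal by (simp add: DERIV_def flat_exp_def)
next
  case greater
  have "((\<lambda>x. exp (- inverse x) * inverse x ^ n) has_real_derivative
      exp (- inverse x) * (inverse x * inverse x) * inverse x ^ n
        + exp (- inverse x) * (real n * inverse x ^ (n - 1) * - (inverse x * inverse x))) (at x)"
    using greater by (auto intro!: derivative_eq_intros)
  also have "exp (- inverse x) * (inverse x * inverse x) * inverse x ^ n
        + exp (- inverse x) * (real n * inverse x ^ (n - 1) * - (inverse x * inverse x))
      = flat_exp (n + 2) x + - real n * flat_exp (n + 1) x"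
    using greater by (cases n) (auto simp: flat_exp_def field_simps)
  finally have "((\<lambda>x. exp (- inverse x) * inverse x ^ n) has_real_derivative
      flat_exp (n + 2) x + - real n * flat_exp (n + 1) x) (at x)" .
  then show ?thesis
    by (rule has_field_derivative_transform_within_open[of _ _ _ "{0<..}"])
      (use greater in \<open>auto simp: flat_exp_def field_simps\<close>)
qed

lemma C_k_flat_exp: "C_k k (flat_exp n)"
proof (induction k arbitrary: n)
  case 0
  show ?case
    using DERIV_continuous_on_UNIV[OF has_real_derivative_flat_exp] by simp
next
  case (Suc k)
  show ?case
    unfolding C_k_Suc_iff
    by (intro exI[of _ "\<lambda>x. flat_exp (n + 2) x + - real n * flat_exp (n + 1) x"] conjI allI
        has_real_derivative_flat_exp C_k_add C_k_cmult Suc)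
qed

text \<open>The shift by \<open>1\<close> keeps the support inside \<open>[a + 1/n, b - 1/n]\<close>, so that intervals reaching up
  to the boundary of the domain are admissible.\<close>

definition bump :: "real \<Rightarrow> real \<Rightarrow> nat \<Rightarrow> real \<Rightarrow> real" where
  "bump a b n x = flat_exp 0 (real n * (x - a) - 1) * flat_exp 0 (real n * (b - x) - 1)"

lemma C_infinity_bump: "C_infinity (bump a b n)"
  unfolding C_infinity_def
proof
  fix k
  have "bump a b n = (\<lambda>x. flat_exp 0 (real n * x + (- real n * a - 1))
      * flat_exp 0 (- real n * x + (real n * b - 1)))"
    by (simp add: bump_def fun_eq_iff algebra_simps)
  then show "C_k k (bump a b n)"
    by (simp only: C_k_mult[OF C_k_affine[OF C_k_flat_exp] C_k_affine[OF C_k_flat_exp]])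
qed

lemma flat_exp_0_bounds: "0 \<le> flat_exp 0 x" "flat_exp 0 x \<le> 1"
  by (auto simp: flat_exp_def)

lemma abs_bump_le: "\<bar>bump a b n x\<bar> \<le> 1"
  using flat_exp_0_bounds by (simp add: bump_def abs_mult mult_le_one)

text \<open>A factor of \<open>bump\<close> is nonzero only where its shifted argument is positive.
  For \<open>n = 0\<close> that argument is always \<open>- 1\<close>, so this bump vanishes
  identically.\<close>

lemma bump_support:
  assumes "bump a b n x \<noteq> 0"
  shows "n > 0" "x \<in> {a + 1 / real n..b - 1 / real n}"
proof -
  have *: "real n * (x - a) > 1" "real n * (b - x) > 1"
    using assms by (auto simp: bump_def flat_exp_def split: if_splits)
  then show "n > 0" by (cases n) auto
  with * show "x \<in> {a + 1 / real n..b - 1 / real n}"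
    by (auto simp: field_simps)
qed

lemma flat_exp_0_tendsto:
  "(\<lambda>n. flat_exp 0 (real n * c - 1)) \<longlonglongrightarrow> (if c > 0 then 1 else 0)"
proof (cases "c > 0")
  case True
  have "((\<lambda>x :: real. exp (- inverse x)) \<longlongrightarrow> exp (- 0)) at_top"
    by (intro tendsto_exp tendsto_minus tendsto_inverse_0_at_top filterlim_ident)
  moreover have "\<forall>\<^sub>F x in at_top. exp (- inverse x) = flat_exp 0 x"
    using eventually_gt_at_top[of 0] by eventually_elim (simp add: flat_exp_def)
  ultimately have "(flat_exp 0 \<longlongrightarrow> exp (- 0)) at_top"
    by (rule Lim_transform_eventually)
  moreover have "filterlim (\<lambda>n. -1 + real n * c) at_top sequentially"
    using True by (intro filterlim_tendsto_add_at_top[OF tendsto_const]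
        filterlim_at_top_mult_tendsto_pos[OF tendsto_const _ filterlim_real_sequentially])
  ultimately show ?thesis
    using True filterlim_compose[of "flat_exp 0" "nhds 1" at_top "\<lambda>n. -1 + real n * c"] by simp
next
  case False
  then have "real n * c \<le> 0" for n by (simp add: mult_nonneg_nonpos)
  then have "flat_exp 0 (real n * c - 1) = 0" for n
    using le_less_trans[of "real n * c" 0 1] by (simp add: flat_exp_def)
  with False show ?thesis by simp
qed

lemma bump_tendsto: "(\<lambda>n. bump a b n x) \<longlonglongrightarrow> indicator {a<..<b} x"
proof -
  have "(\<lambda>n. bump a b n x) \<longlonglongrightarrow> (if x - a > 0 then 1 else 0) * (if b - x > 0 then 1 else 0)"
    unfolding bump_def by (intro tendsto_mult flat_exp_0_tendsto)
  then show ?thesis by (simp add: indicator_def split: if_splits)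
qed

section \<open>Test functions with prescribed derivative, and the lemma of du Bois-Reymond\<close>

lemma C_infinity_continuous: "C_infinity f \<Longrightarrow> continuous_on UNIV f"
  unfolding C_infinity_def using C_k.simps(1) by blast

text \<open>The primitive starting at \<open>a\<close> vanishes to the left of \<open>a\<close>
  because \<open>\<psi>\<close> does, and to the right of \<open>b\<close> because the total
  integral is 0; hence its support is compact.\<close>

lemma test_function_primitive:
  fixes \<psi> :: "real \<Rightarrow> real"
  assumes smooth: "C_infinity \<psi>" and supp: "\<And>x. \<psi> x \<noteq> 0 \<Longrightarrow> x \<in> {a..b}"
    and sub: "{a..b} \<subseteq> U" and mean: "(LINT x|lborel. \<psi> x) = 0"
  obtains \<eta> where "\<eta> \<in> test_functions U" "\<And>x. (\<eta> has_real_derivative \<psi> x) (at x)"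
proof (cases "a \<le> b")
  case True
  have cont: "continuous_on A \<psi>" for A
    by (rule continuous_on_subset[OF C_infinity_continuous[OF smooth]]) simp
  define \<eta> where "\<eta> x = (LBINT y=ereal a..ereal x. \<psi> y)" for x
  have d: "(\<eta> has_real_derivative \<psi> x) (at x)" for x
  proof -
    have "(\<eta> has_vector_derivative \<psi> x) (at x within {min a x - 1..max a x + 1})"
      unfolding \<eta>_def[abs_def] by (rule interval_integral_FTC2) (auto intro: cont)
    then show ?thesis
      by (simp add: has_real_derivative_iff_has_vector_derivative at_within_Icc_at)
  qed
  have \<eta>a: "\<eta> a = 0" by (simp add: \<eta>_def)
  have "\<eta> b - \<eta> a = (LINT x|lborel. \<psi> x * indicator {a..b} x)"
    using cont[of UNIV] by (intro integral_FTC_Icc_real[symmetric] True d)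
      (auto simp: continuous_on_eq_continuous_at)
  also have "(\<lambda>x. \<psi> x * indicator {a..b} x) = \<psi>"
    using supp by (intro ext) (auto split: split_indicator)
  finally have \<eta>b: "\<eta> b = 0" using mean \<eta>a by simp
  have out: "\<eta> x = 0" if x: "x \<notin> {a..b}" for x
  proof -
    consider "x < a" | "b < x" using x by force
    then show ?thesis
    proof cases
      case 1
      obtain z where z: "x < z" "z < a" "\<eta> a - \<eta> x = (a - x) * \<psi> z"
        using MVT2[OF 1 d] by auto
      moreover have "\<psi> z = 0" using supp[of z] z by force
      ultimately show ?thesis using \<eta>a by simp
    next
      case 2
      obtain z where z: "b < z" "z < x" "\<eta> x - \<eta> b = (x - b) * \<psi> z"
        using MVT2[OF 2 d] by auto
      moreover have "\<psi> z = 0" using supp[of z] z by force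
      ultimately show ?thesis using \<eta>b by simp
    qed
  qed
  have cl: "closure {x. \<eta> x \<noteq> 0} \<subseteq> {a..b}"
  proof (rule closure_minimal)
    show "{x. \<eta> x \<noteq> 0} \<subseteq> {a..b}" using out by blast
  qed simp
  have "C_k k \<eta>" for k
  proof (rule C_k_lower)
    show "C_k (Suc k) \<eta>"
      unfolding C_k_Suc_iff using d smooth by (auto simp: C_infinity_def)
  qed
  then have "\<eta> \<in> test_functions U"
    using cl sub bounded_subset[OF bounded_closed_interval cl]
    by (auto simp: test_functions_def C_infinity_def compact_eq_bounded_closed)
  then show ?thesis using d that by blast
next
  case False
  \<comment> \<open>An empty interval leaves only \<open>\<psi> = 0\<close>; in the application to
    bumps this occurs for small \<open>n\<close>.\<close>
  then have "\<psi> x = 0" for x using supp[of x] by force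
  then show ?thesis
    by (intro that[of "\<lambda>_. 0"]) (auto simp: test_functions_def C_infinity_def C_k_zero)
qed

text \<open>A Dynkin argument: the half-lines are an intersection-stable generator of the Borel
  sets, so the integral of \<open>f\<close> vanishes over every Borel set, which forces
  \<open>f\<close> to be zero almost everywhere.\<close>

lemma AE_zero_if_integral_atMost_zero:
  fixes f :: "real \<Rightarrow> 'b::{banach, second_countable_topology}"
  assumes f: "integrable lborel f" and z: "\<And>x. (LINT t|lborel. indicator {..x} t *\<^sub>R f t) = 0"
  shows "AE t in lborel. f t = 0"
proof (rule sigma_finite_measure.density_zero[OF sigma_finite_lborel f])
  fix A :: "real set" assume "A \<in> sets lborel"
  then have A: "A \<in> sigma_sets UNIV (range atMost)"
    by (simp add: borel_eq_atMost)
  have stable: "Int_stable (range (atMost :: real \<Rightarrow> _))"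
    by (intro Int_stableI) auto
  have int: "integrable lborel (\<lambda>t. indicator A t *\<^sub>R f t)" if "A \<in> sets borel" for A
    using f that integrable_mult_indicator[of A lborel f] by simp
  \<comment> \<open>Passing to complements needs the integral over the whole line, which is a limit
    over growing half-lines.\<close>
  have total: "(LINT t|lborel. f t) = 0"
  proof -
    have "(\<lambda>n. LINT t|lborel. indicator {..real n} t *\<^sub>R f t) \<longlonglongrightarrow> (LINT t|lborel. f t)"
    proof (rule integral_dominated_convergence[where w = "\<lambda>t. norm (f t)"])
      show "AE t in lborel. (\<lambda>n. indicator {..real n} t *\<^sub>R f t) \<longlonglongrightarrow> f t"
      proof (rule AE_I2, rule tendsto_eventually)
        fix t :: real
        obtain N :: nat where "t \<le> real N" using real_arch_simple by blast
        then show "\<forall>\<^sub>F n in sequentially. indicator {..real n} t *\<^sub>R f t = f t"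
          by (intro eventually_sequentiallyI[of N]) (auto simp: indicator_def)
      qed
    qed (use f in \<open>auto simp: indicator_def\<close>)
    then show ?thesis by (simp add: z LIMSEQ_const_iff)
  qed
  from stable subset_UNIV[of "range atMost", folded Pow_UNIV] A
  show "set_lebesgue_integral lborel A f = 0"
  proof (induction A rule: sigma_sets_induct_disjoint)
    case (basic A)
    then show ?case by (auto simp: set_lebesgue_integral_def z)
  next
    case (compl A)
    then have A: "A \<in> sets borel" by (simp add: borel_eq_atMost)
    have "(\<lambda>t. indicator (UNIV - A) t *\<^sub>R f t) = (\<lambda>t. f t - indicator A t *\<^sub>R f t)"
      by (intro ext) (auto split: split_indicator)
    then show ?case
      using compl f int[OF A] by (simp add: set_lebesgue_integral_def total)
  next
    case (union A)
    then have A: "A i \<in> sets borel" for i by (auto simp: borel_eq_atMost)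
    have "(LINT t:(\<Union>i. A i)|lborel. f t) = (\<Sum>i. LINT t:A i|lborel. f t)"
      using A union(1) int[of "\<Union>i. A i"]
      by (intro lebesgue_integral_countable_add)
        (auto simp: set_integrable_def disjoint_family_on_def)
    then show ?case using union by simp
  qed (auto simp: set_lebesgue_integral_def)
qed

text \<open>Two bumps, weighted by each other's mass, differ by the derivative of a test function. As they
  sharpen, the mean of \<open>h\<close> over any initial interval \<open>(0, y)\<close> is seen to equal the one over \<open>(0, T)\<close>.\<close>

lemma du_Bois_Reymond:
  fixes h :: "real \<Rightarrow> 'b::{banach, second_countable_topology}"
  assumes T: "T > 0" and h: "integrable lborel h"
    and orth: "\<And>\<eta>. \<eta> \<in> test_functions {0<..<T} \<Longrightarrow>
      (LINT t|lborel. frechet_derivative \<eta> (at t) 1 *\<^sub>R h t) = 0"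
  shows "AE t in lborel. t \<in> {0<..<T} \<longrightarrow>
    h t = (1 / T) *\<^sub>R (LINT t|lborel. indicator {0<..<T} t *\<^sub>R h t)"
proof -
  define I where "I a b = (LINT t|lborel. indicator {a<..<b} t *\<^sub>R h t)" for a b
  define \<beta> where "\<beta> a b n = (LINT t|lborel. bump a b n t)" for a b n
  define H where "H a b n = (LINT t|lborel. bump a b n t *\<^sub>R h t)" for a b n
  have [measurable]: "bump a b n \<in> borel_measurable borel" for a b n
    by (rule borel_measurable_continuous_onI[OF C_infinity_continuous[OF C_infinity_bump]])
  have [measurable]: "h \<in> borel_measurable borel" using h by auto
  have bint: "integrable lborel (bump a b n)" for a b n
    by (rule square_integrable_compact_support(2)
        [OF C_infinity_continuous[OF C_infinity_bump] compact_Icc bump_support(2)])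
  have hint: "integrable lborel (\<lambda>t. bump a b n t *\<^sub>R h t)" for a b n
    by (rule Bochner_Integration.integrable_bound[OF h])
      (auto simp: abs_bump_le mult_left_le_one_le)
  have iint: "integrable lborel (\<lambda>t. indicator A t *\<^sub>R h t)" if "A \<in> sets borel" for A
    using h that integrable_mult_indicator[of A lborel h] by simp
  have \<beta>_lim: "\<beta> a b \<longlonglongrightarrow> b - a" if "a \<le> b" for a b
  proof -
    have "\<beta> a b \<longlonglongrightarrow> (LINT t|lborel. indicator {a<..<b} t)"
      unfolding \<beta>_def
    proof (rule integral_dominated_convergence[where w = "indicator {a..b}"])
      show "AE t in lborel. norm (bump a b n t) \<le> indicator {a..b} t" for n
      proof (rule AE_I2)
        fix t
        have "t \<in> {a..b}" if "bump a b n t \<noteq> 0"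
        proof -
          have "a + 1 / real n \<le> t" "t \<le> b - 1 / real n" "0 \<le> 1 / real n"
            using bump_support(2)[OF that] by auto
          then have "a \<le> t \<and> t \<le> b" by linarith
          then show ?thesis by simp
        qed
        then show "norm (bump a b n t) \<le> indicator {a..b} t"
          using abs_bump_le[of a b n t] by (cases "bump a b n t = 0") auto
      qed
      show "integrable lborel (indicator {a..b} :: real \<Rightarrow> real)"
        using that by (intro integrable_real_indicator) auto
    qed (auto simp: bump_tendsto)
    with that show ?thesis by simp
  qed
  have H_lim: "H a b \<longlonglongrightarrow> I a b" for a b
    unfolding H_def I_def
    by (rule integral_dominated_convergence[where w = "\<lambda>t. norm (h t)"])
      (auto simp: h abs_bump_le mult_left_le_one_le intro!: tendsto_scaleR bump_tendsto)
  have mean: "\<beta> 0 T n *\<^sub>R H a b n = \<beta> a b n *\<^sub>R H 0 T n" if ab: "0 \<le> a" "b \<le> T" for a b n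
  proof -
    define \<psi> where "\<psi> t = \<beta> 0 T n * bump a b n t + - \<beta> a b n * bump 0 T n t" for t
    have smooth: "C_infinity \<psi>"
      unfolding \<psi>_def[abs_def] C_infinity_def
      by (intro allI C_k_add C_k_cmult C_infinity_bump[unfolded C_infinity_def, rule_format])
    have supp: "n > 0 \<and> t \<in> {1 / real n..T - 1 / real n}" if "\<psi> t \<noteq> 0" for t
    proof -
      from that have "bump a b n t \<noteq> 0 \<or> bump 0 T n t \<noteq> 0" by (auto simp: \<psi>_def)
      then show ?thesis
        using bump_support[of a b n t] bump_support[of 0 T n t] ab by auto
    qed
    \<comment> \<open>For \<open>n = 0\<close> the quotient \<open>1 / real n\<close> is 0 and the
      interval would be all of \<open>[0, T]\<close>. The lower end \<open>T + 1\<close> makes it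
      empty instead, which is correct as both bumps then vanish.\<close>
    let ?l = "if n = 0 then T + 1 else 1 / real n"
    have sub: "{?l..T - 1 / real n} \<subseteq> {0<..<T}"
    proof
      fix t assume t: "t \<in> {?l..T - 1 / real n}"
      then have "n > 0" by (cases n) auto
      with t have "1 / real n \<le> t" "t \<le> T - 1 / real n" by auto
      moreover from \<open>n > 0\<close> have "0 < 1 / real n" by simp
      ultimately have "0 < t \<and> t < T" by linarith
      then show "t \<in> {0<..<T}" by simp
    qed
    have supp': "t \<in> {?l..T - 1 / real n}" if "\<psi> t \<noteq> 0" for t
      using supp[OF that] by auto
    have "(LINT t|lborel. \<psi> t) = 0"
      unfolding \<psi>_def using bint by (simp add: \<beta>_def)
    from test_function_primitive[OF smooth supp' sub this] obtain \<eta> where \<eta>: "\<eta> \<in> test_functions {0<..<T}" "\<And>t. (\<eta> has_real_derivative \<psi> t) (at t)"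
      by metis
    have "0 = (LINT t|lborel. \<psi> t *\<^sub>R h t)"
      using orth[OF \<eta>(1)] by (simp add: frechet_derivative_real[OF \<eta>(2)])
    also have "\<dots> = (LINT t|lborel. \<beta> 0 T n *\<^sub>R (bump a b n t *\<^sub>R h t) - \<beta> a b n *\<^sub>R (bump 0 T n t *\<^sub>R h t))"
      by (rule Bochner_Integration.integral_cong) (auto simp: \<psi>_def algebra_simps)
    also have "\<dots> = \<beta> 0 T n *\<^sub>R H a b n - \<beta> a b n *\<^sub>R H 0 T n"
      unfolding H_def
      by (subst Bochner_Integration.integral_diff)
        (intro integrable_scaleR_right hint, intro integrable_scaleR_right hint,
          simp only: integral_scaleR_right)
    finally show ?thesis by simp
  qed
  have I_eq: "T *\<^sub>R I 0 y = y *\<^sub>R I 0 T" if y: "0 \<le> y" "y \<le> T" for y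
  proof (rule LIMSEQ_unique)
    show "(\<lambda>n. \<beta> 0 T n *\<^sub>R H 0 y n) \<longlonglongrightarrow> T *\<^sub>R I 0 y"
      using tendsto_scaleR[OF \<beta>_lim[of 0 T] H_lim[of 0 y]] T by simp
    show "(\<lambda>n. \<beta> 0 T n *\<^sub>R H 0 y n) \<longlonglongrightarrow> y *\<^sub>R I 0 T"
      using tendsto_scaleR[OF \<beta>_lim[of 0 y] H_lim[of 0 T]] y by (simp add: mean)
  qed
  define C where "C = (1 / T) *\<^sub>R I 0 T"
  have cint: "integrable lborel (\<lambda>t. indicator {0<..<y} t *\<^sub>R C)" for y :: real
    by (intro integrable_scaleR_left) (cases "0 \<le> y"; simp add: integrable_indicator_iff)
  have "AE t in lborel. indicator {0<..<T} t *\<^sub>R h t - indicator {0<..<T} t *\<^sub>R C = 0"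
  proof (rule AE_zero_if_integral_atMost_zero)
    show "integrable lborel (\<lambda>t. indicator {0<..<T} t *\<^sub>R h t - indicator {0<..<T} t *\<^sub>R C)"
      by (intro Bochner_Integration.integrable_diff iint cint) simp
    fix x :: real
    \<comment> \<open>Clamping \<open>x\<close> to \<open>[0, T]\<close>: the half-line up to
      \<open>x\<close> meets \<open>(0, T)\<close> in \<open>(0, y)\<close>, up to the single point
      \<open>x\<close>.\<close>
    define y where "y = max 0 (min x T)"
    have y: "0 \<le> y" "y \<le> T" using T by (auto simp: y_def)
    have "(LINT t|lborel. indicator {..x} t *\<^sub>R (indicator {0<..<T} t *\<^sub>R h t - indicator {0<..<T} t *\<^sub>R C))
        = (LINT t|lborel. indicator {0<..<y} t *\<^sub>R h t - indicator {0<..<y} t *\<^sub>R C)"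
    proof (rule integral_cong_AE)
      show "AE t in lborel. indicator {..x} t *\<^sub>R (indicator {0<..<T} t *\<^sub>R h t - indicator {0<..<T} t *\<^sub>R C)
          = indicator {0<..<y} t *\<^sub>R h t - indicator {0<..<y} t *\<^sub>R C"
        using AE_lborel_singleton[of x]
        by eventually_elim (auto simp: y_def indicator_def)
    qed measurable
    also have "\<dots> = I 0 y - y *\<^sub>R C"
      using y by (subst Bochner_Integration.integral_diff[OF iint cint]) (auto simp: I_def)
    also have "y *\<^sub>R C = (1 / T) *\<^sub>R (T *\<^sub>R I 0 y)"
      by (simp add: I_eq[OF y] C_def)
    also have "\<dots> = I 0 y" using T by simp
    finally show "(LINT t|lborel. indicator {..x} t *\<^sub>R (indicator {0<..<T} t *\<^sub>R h t
        - indicator {0<..<T} t *\<^sub>R C)) = 0" by simp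
  qed
  then show ?thesis
    by eventually_elim (auto simp: C_def I_def)
qed

section \<open>Primitives of Bochner integrable functions\<close>

text \<open>The half-line avoids oriented integrals. For integrands that vanish outside
  \<open>[0, T]\<close> and for \<open>t \<ge> 0\<close> this is the integral from 0 to
  \<open>t\<close>.\<close>

definition primitive :: "(real \<Rightarrow> 'v::{banach, second_countable_topology}) \<Rightarrow> real \<Rightarrow> 'v" where
  "primitive z t = (LINT s|lborel. indicator {..t} s *\<^sub>R z s)"

text \<open>Dominated convergence: the indicators of the half-lines converge except possibly at the
  single point \<open>s = t\<close>.\<close>

lemma continuous_on_primitive:
  assumes z: "integrable lborel z"
  shows "continuous_on A (primitive z)"
proof -
  have [measurable]: "z \<in> borel_measurable borel" using z by auto
  have "(\<lambda>n. primitive z (u n)) \<longlonglongrightarrow> primitive z t" if u: "u \<longlonglongrightarrow> t" for u t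
    unfolding primitive_def
  proof (rule integral_dominated_convergence[where w = "\<lambda>s. norm (z s)"])
    show "AE s in lborel. (\<lambda>n. indicator {..u n} s *\<^sub>R z s) \<longlonglongrightarrow> indicator {..t} s *\<^sub>R z s"
      using AE_lborel_singleton[of t]
    proof eventually_elim
      fix s assume "s \<noteq> t"
      then consider "s < t" | "t < s" by force
      then have "\<forall>\<^sub>F n in sequentially. indicator {..u n} s *\<^sub>R z s = indicator {..t} s *\<^sub>R z s"
      proof cases
        case 1
        show ?thesis
          using order_tendstoD(1)[OF u 1]
            by eventually_elim (use 1 in \<open>auto simp: indicator_def\<close>)
      next
        case 2
        show ?thesis
          using order_tendstoD(2)[OF u 2]
            by eventually_elim (use 2 in \<open>auto simp: indicator_def\<close>)
      qed
      then show "(\<lambda>n. indicator {..u n} s *\<^sub>R z s) \<longlonglongrightarrow> indicator {..t} s *\<^sub>R z s"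
        by (rule tendsto_eventually)
    qed
  qed (use z in \<open>auto simp: indicator_def\<close>)
  then show ?thesis
    by (auto simp: continuous_on_sequentially o_def)
qed

text \<open>Integration over the half-plane \<open>s \<le> t\<close> in both orders. With
  \<open>k\<close> the derivative of a test function it yields integration by parts, with
  \<open>k\<close> the indicator of \<open>(0, T)\<close> the weight \<open>T - s\<close> of
  \<open>trace0\<close>.\<close>

lemma Fubini_primitive:
  fixes k :: "real \<Rightarrow> real" and z :: "real \<Rightarrow> 'v::{banach, second_countable_topology}"
  assumes k: "integrable lborel k" and z: "integrable lborel z"
  shows "integrable lborel (\<lambda>t. k t *\<^sub>R primitive z t)"
    and "(LINT t|lborel. k t *\<^sub>R primitive z t)
      = (LINT s|lborel. (LINT t|lborel. k t * indicator {s..} t) *\<^sub>R z s)"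
proof -
  have [measurable]: "k \<in> borel_measurable borel" "z \<in> borel_measurable borel" using k z by auto
  have prod: "integrable (lborel \<Otimes>\<^sub>M lborel) (\<lambda>p. k (fst p) *\<^sub>R z (snd p))"
    using k z by (intro lborel_pair.Fubini_integrable) auto
  define G where "G t s = (if s \<le> t then k t *\<^sub>R z s else 0)" for t s
  have G: "integrable (lborel \<Otimes>\<^sub>M lborel) (case_prod G)"
  proof (rule Bochner_Integration.integrable_bound[OF prod])
    show "case_prod G \<in> borel_measurable (lborel \<Otimes>\<^sub>M lborel)"
      unfolding G_def case_prod_beta by measurable
  qed (auto simp: G_def)
  have inner: "(LINT s|lborel. G t s) = k t *\<^sub>R primitive z t" for t
  proof -
    have "(LINT s|lborel. G t s) = (LINT s|lborel. k t *\<^sub>R (indicator {..t} s *\<^sub>R z s))"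
      by (rule Bochner_Integration.integral_cong) (auto simp: G_def indicator_def)
    then show ?thesis unfolding primitive_def by (simp only: integral_scaleR_right)
  qed
  have outer: "(LINT t|lborel. G t s) = (LINT t|lborel. k t * indicator {s..} t) *\<^sub>R z s" for s
  proof -
    have int: "integrable lborel (\<lambda>t. k t * indicator {s..} t)"
      by (rule Bochner_Integration.integrable_bound[OF k]) (auto simp: indicator_def)
    have "(LINT t|lborel. G t s) = (LINT t|lborel. (k t * indicator {s..} t) *\<^sub>R z s)"
      by (rule Bochner_Integration.integral_cong) (auto simp: G_def indicator_def)
    then show ?thesis using int by simp
  qed
  show "integrable lborel (\<lambda>t. k t *\<^sub>R primitive z t)"
    using lborel_pair.integrable_fst'[OF G] by (simp add: inner)
  show "(LINT t|lborel. k t *\<^sub>R primitive z t)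
      = (LINT s|lborel. (LINT t|lborel. k t * indicator {s..} t) *\<^sub>R z s)"
    using lborel_pair.Fubini_integral[OF G] by (simp add: inner outer)
qed

text \<open>After exchanging the integrals, the fundamental theorem is needed only for the scalar
  function \<open>\<eta>\<close>, whose derivative integrates to \<open>- \<eta> s\<close> over
  \<open>[s, \<infinity>)\<close>.\<close>

lemma test_function_by_parts:
  fixes z :: "real \<Rightarrow> 'v::{banach, second_countable_topology}"
  assumes \<eta>: "\<eta> \<in> test_functions U" and z: "integrable lborel z"
  shows "integrable lborel (\<lambda>t. frechet_derivative \<eta> (at t) 1 *\<^sub>R primitive z t)"
    and "(LINT t|lborel. frechet_derivative \<eta> (at t) 1 *\<^sub>R primitive z t)
      = - (LINT t|lborel. \<eta> t *\<^sub>R z t)"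
proof -
  let ?d = "\<lambda>t. frechet_derivative \<eta> (at t) 1"
  note Fub = Fubini_primitive[OF test_functionsD(7)[OF \<eta>] z]
  show "integrable lborel (\<lambda>t. ?d t *\<^sub>R primitive z t)" by (rule Fub(1))
  obtain B where B: "\<And>t. t \<in> closure {x. \<eta> x \<noteq> 0} \<Longrightarrow> \<bar>t\<bar> \<le> B"
    using compact_imp_bounded[OF test_functionsD(1)[OF \<eta>]] by (auto simp: bounded_iff)
  have "(LINT t|lborel. ?d t * indicator {s..} t) = - \<eta> s" for s
  proof -
    \<comment> \<open>Lies beyond both \<open>s\<close> and the support of \<open>\<eta>\<close>:
      the integral is truncated to a compact interval and \<open>\<eta> b = 0\<close>.\<close>
    define b where "b = max s (B + 1)"
    have supp: "\<eta> t = 0" if "t > B" for t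
      using B[of t] that closure_subset[of "{x. \<eta> x \<noteq> 0}"] by force
    have dsupp: "?d t = 0" if "t > B" for t
      using B[OF frechet_derivative_support[of \<eta> t 1]] that by force
    have eq: "?d t * indicator {s..} t = ?d t * indicator {s..b} t" for t
      using dsupp[of t] by (cases "t > b") (auto simp: b_def indicator_def)
    have "(LINT t|lborel. ?d t * indicator {s..} t) = (LINT t|lborel. ?d t * indicator {s..b} t)"
      by (simp only: eq)
    also have "\<dots> = \<eta> b - \<eta> s"
    proof (rule integral_FTC_Icc_real)
      show "isCont ?d t" for t
        using test_functionsD(4)[OF \<eta>, of 1] by (simp add: continuous_on_eq_continuous_at)
    qed (auto simp: b_def intro: has_real_derivative_frechet test_functionsD(3)[OF \<eta>])
    also have "\<eta> b = 0" by (rule supp) (simp add: b_def)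
    finally show ?thesis by simp
  qed
  then show "(LINT t|lborel. ?d t *\<^sub>R primitive z t) = - (LINT t|lborel. \<eta> t *\<^sub>R z t)"
    using Fub(2) by simp
qed

section \<open>Sobolev functions of time\<close>

lemma rep_L2_on_Icc:
  fixes T :: real
  assumes "f \<in> L2_on {0..T}"
  shows "AE t in lborel. rep_L2 f t = indicator {0<..<T} t *\<^sub>R rep_L2 f t"
proof -
  have "AE t in lborel. t \<notin> {0..T} \<longrightarrow> rep_L2 f t = 0" using assms by (simp add: L2_on_def)
  with AE_lborel_singleton[of 0] AE_lborel_singleton[of T] show ?thesis
    by eventually_elim (auto simp: indicator_def)
qed

lemma square_integrable_Ioo: "square_integrable (indicator {a<..<b :: real} :: real \<Rightarrow> real)"
  using square_integrable_indicator[of "{a<..<b}" "1 :: real"]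
  by (cases "a \<le> b") (auto simp: indicator_def[abs_def])

lemma square_integrable_linear_weight:
  "square_integrable (\<lambda>s :: real. indicator {0<..<T} s * (T - s))"
proof (rule square_integrable_dominated)
  show "integrable lborel (\<lambda>s. indicator {0<..<T} s * T\<^sup>2 :: real)"
    by (intro integrable_mult_left integrable_real_indicator) (cases "0 \<le> T"; simp)+
  show "(norm (indicator {0<..<T} s * (T - s)))\<^sup>2 \<le> indicator {0<..<T} s * T\<^sup>2" for s
    by (auto simp: indicator_def intro!: power_mono)
qed measurable

text \<open>Almost everywhere \<open>f\<close> is its own product with the indicator of
  \<open>(0, T)\<close>, which is square integrable since the interval is bounded.\<close>

lemma integrable_rep_L2_on:
  fixes T :: real
  assumes "f \<in> L2_on {0..T}"
  shows "integrable lborel (rep_L2 f)"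
  using integrable_pairing(1)[OF square_integrable_Ioo[of 0 T] square_integrable_rep[of f]]
  by (rule integrable_cong_AE_imp) (use rep_L2_on_Icc[OF assms] in auto)

text \<open>Averaging \<open>f t = f 0 + \<integral>\<^sub>0\<^sup>t f'\<close> over \<open>(0, T)\<close> expresses \<open>f 0\<close> by two integrals that make sense for
  arbitrary pairs of square integrable functions. So the trace at \<open>0\<close> extends to a bounded linear map
  on the whole ambient space.\<close>

definition trace0 ::
    "real \<Rightarrow> (real, 'v::{banach, second_countable_topology}) L2 \<times> (real, 'v) L2 \<Rightarrow> 'v" where
  "trace0 T = (\<lambda>(f, f'). (1 / T) *\<^sub>R
     ((LINT t|lborel. indicator {0<..<T} t *\<^sub>R rep_L2 f t)
      - (LINT s|lborel. (indicator {0<..<T} s * (T - s)) *\<^sub>R rep_L2 f' s)))"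

lemma bounded_linear_trace0: "bounded_linear (trace0 T)"
  unfolding trace0_def case_prod_beta
  by (intro bounded_linear_compose[OF bounded_linear_scaleR_right] bounded_linear_sub
      bounded_linear_compose[OF bounded_linear_pairing[OF square_integrable_Ioo] bounded_linear_fst]
      bounded_linear_compose[OF bounded_linear_pairing[OF square_integrable_linear_weight] bounded_linear_snd])

text \<open>On \<open>(0, T)\<close> the difference of \<open>f\<close> and the primitive of
  \<open>f'\<close> has weak derivative zero, hence equals its mean; exchanging integrals identifies
  this mean as \<open>trace0 T (f, f')\<close>.\<close>

lemma trace0_representation:
  assumes T: "T > 0" and f: "f \<in> L2_on {0..T}" and f': "f' \<in> L2_on {0..T}"
    and weak: "weak_partial {0<..<T} 1 (rep_L2 f) (rep_L2 f')"
  shows "AE t in lborel. t \<in> {0..T} \<longrightarrow> rep_L2 f t = trace0 T (f, f') + primitive (rep_L2 f') t"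
proof -
  define J where "J = primitive (rep_L2 f')"
  have J: "continuous_on A J" for A
    unfolding J_def by (intro continuous_on_primitive integrable_rep_L2_on[OF f'])
  have [measurable]: "J \<in> borel_measurable borel"
    by (rule borel_measurable_continuous_onI[OF J])
  \<comment> \<open>Beyond \<open>T\<close> the primitive is constant and in general not integrable,
    hence the indicators.\<close>
  define h where "h t = indicator {0<..<T} t *\<^sub>R rep_L2 f t - indicator {0<..<T} t *\<^sub>R J t" for t
  have If: "integrable lborel (\<lambda>t. indicator {0<..<T} t *\<^sub>R rep_L2 f t)"
    by (rule integrable_pairing(1)[OF square_integrable_Ioo square_integrable_rep])
  have ind: "integrable lborel (indicator {0<..<T} :: real \<Rightarrow> real)"
    using T by (intro integrable_real_indicator) auto
  note IJ = Fubini_primitive[OF ind integrable_rep_L2_on[OF f'], folded J_def]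
  have h: "integrable lborel h"
    unfolding h_def by (intro Bochner_Integration.integrable_diff If IJ)
  have "AE t in lborel. t \<in> {0<..<T} \<longrightarrow>
      h t = (1 / T) *\<^sub>R (LINT t|lborel. indicator {0<..<T} t *\<^sub>R h t)"
  proof (rule du_Bois_Reymond[OF T h])
    fix \<eta> :: "real \<Rightarrow> real" assume \<eta>: "\<eta> \<in> test_functions {0<..<T}"
    let ?d = "\<lambda>t. frechet_derivative \<eta> (at t) 1"
    note parts = test_function_by_parts[OF \<eta> integrable_rep_L2_on[OF f'], folded J_def]
    have "?d t = 0" if "t \<notin> {0<..<T}" for t
      using frechet_derivative_support[of \<eta> t 1] test_functionsD(2)[OF \<eta>] that by blast
    then have "?d t *\<^sub>R h t = ?d t *\<^sub>R rep_L2 f t - ?d t *\<^sub>R J t" for t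
      by (cases "t \<in> {0<..<T}") (auto simp: h_def scaleR_diff_right)
    then have "(LINT t|lborel. ?d t *\<^sub>R h t)
        = (LINT t|lborel. ?d t *\<^sub>R rep_L2 f t) - (LINT t|lborel. ?d t *\<^sub>R J t)"
      by (simp add: parts(1) integrable_pairing(1)[OF test_functionsD(6)[OF \<eta>] square_integrable_rep])
    also have "\<dots> = 0"
      using weak \<eta> parts(2) by (simp add: weak_partial_def)
    finally show "(LINT t|lborel. ?d t *\<^sub>R h t) = 0" .
  qed
  moreover have "(1 / T) *\<^sub>R (LINT t|lborel. indicator {0<..<T} t *\<^sub>R h t) = trace0 T (f, f')"
  proof -
    \<comment> \<open>Equals \<open>T - s\<close> on \<open>(0, T)\<close> but not for
      \<open>s \<le> 0\<close>. The discrepancy is harmless because \<open>rep_L2 f'\<close>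
      vanishes almost everywhere outside the interval.\<close>
    define W :: "real \<Rightarrow> real"
      where "W s = (LINT t|lborel. indicator {0<..<T} t * indicator {s..} t)" for s
    have W: "W s = T - s" if "s \<in> {0<..<T}" for s
    proof -
      have "W s = (LINT t|lborel. indicator {s..<T} t)"
        unfolding W_def using that
        by (intro Bochner_Integration.integral_cong) (auto simp: indicator_def)
      then show ?thesis using that by simp
    qed
    have [measurable]: "W \<in> borel_measurable borel"
    proof -
      have "W = (\<lambda>s. LINT t|lborel. indicator {0<..<T} t * (if s \<le> t then 1 else 0))"
        unfolding W_def by (intro ext Bochner_Integration.integral_cong) (auto simp: indicator_def)
      also have "\<dots> \<in> borel_measurable borel" by measurable
      finally show ?thesis .
    qed
    have "(LINT t|lborel. indicator {0<..<T} t *\<^sub>R h t) = (LINT t|lborel. h t)"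
      by (intro Bochner_Integration.integral_cong) (auto simp: h_def indicator_def)
    also have "\<dots> = (LINT t|lborel. indicator {0<..<T} t *\<^sub>R rep_L2 f t)
        - (LINT t|lborel. indicator {0<..<T} t *\<^sub>R J t)"
      unfolding h_def by (intro Bochner_Integration.integral_diff If IJ)
    also have "(LINT t|lborel. indicator {0<..<T} t *\<^sub>R J t)
        = (LINT s|lborel. (indicator {0<..<T} s * (T - s)) *\<^sub>R rep_L2 f' s)"
      unfolding IJ(2) W_def[symmetric]
    proof (rule integral_cong_AE)
      show "AE s in lborel. W s *\<^sub>R rep_L2 f' s = (indicator {0<..<T} s * (T - s)) *\<^sub>R rep_L2 f' s"
        using rep_L2_on_Icc[OF f']
      proof eventually_elim
        case (elim s)
        then show ?case
          using W[of s] by (cases "s \<in> {0<..<T}") (auto simp: indicator_def)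
      qed
    qed measurable
    finally show ?thesis by (simp add: trace0_def)
  qed
  ultimately have "AE t in lborel. t \<in> {0<..<T} \<longrightarrow> h t = trace0 T (f, f')" by simp
  with AE_lborel_singleton[of 0] AE_lborel_singleton[of T] show ?thesis
  proof eventually_elim
    case (elim t)
    then show ?case by (auto simp: h_def J_def algebra_simps)
  qed
qed

section \<open>The value at time 0\<close>

lemma continuous_AE_eq_at_0:
  fixes c d :: "real \<Rightarrow> 'v::real_normed_vector"
  assumes T: "T > 0" and c: "continuous_on {0..T} c" and d: "continuous_on {0..T} d"
    and eq: "AE t in lborel. t \<in> {0..T} \<longrightarrow> c t = d t"
  shows "c 0 = d 0"
proof (rule ccontr)
  assume "c 0 \<noteq> d 0"
  then have pos: "norm (c 0 - d 0) > 0" by simp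
  have "continuous_on {0..T} (\<lambda>t. c t - d t)" by (intro continuous_intros c d)
  from this[unfolded continuous_on_iff, rule_format, of 0 "norm (c 0 - d 0)"] T pos
  obtain \<delta> where \<delta>: "\<delta> > 0"
    "\<And>t. t \<in> {0..T} \<Longrightarrow> dist t 0 < \<delta> \<Longrightarrow> dist (c t - d t) (c 0 - d 0) < norm (c 0 - d 0)"
    by auto
  have ne: "c t \<noteq> d t" if "t \<in> {0..T}" "t < \<delta>" for t
    using \<delta>(2)[of t] that by (auto simp: dist_norm norm_minus_commute)
  \<comment> \<open>On \<open>(0, m)\<close> the two functions differ everywhere by continuity, yet
    this interval has positive measure.\<close>
  define m where "m = min \<delta> T"
  have m: "m > 0" using \<delta> T by (simp add: m_def)
  from eq have "AE t in lborel. t \<notin> {0<..<m}"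
    by eventually_elim (use ne in \<open>force simp: m_def\<close>)
  then have "{0<..<m} \<in> null_sets lborel"
    by (subst AE_iff_null_sets) auto
  then show False using m by (auto simp: null_sets_def)
qed

lemma initial_value_eqI:
  assumes T: "T > 0" and c: "continuous_on {0..T} c"
    and eq: "AE t in lborel. t \<in> {0..T} \<longrightarrow> rep_L2 f t = c t"
  shows "initial_value T f = c 0"
  unfolding initial_value_def
proof (rule the_equality)
  show "\<exists>c'. continuous_on {0..T} c' \<and> (AE t in lborel. t \<in> {0..T} \<longrightarrow> rep_L2 f t = c' t) \<and> c' 0 = c 0"
    using c eq by blast
  fix v assume "\<exists>c'. continuous_on {0..T} c' \<and> (AE t in lborel. t \<in> {0..T} \<longrightarrow> rep_L2 f t = c' t) \<and> c' 0 = v"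
  then obtain c' where c': "continuous_on {0..T} c'"
    "AE t in lborel. t \<in> {0..T} \<longrightarrow> rep_L2 f t = c' t" "c' 0 = v" by blast
  have "AE t in lborel. t \<in> {0..T} \<longrightarrow> c' t = c t"
    using c'(2) eq by eventually_elim auto
  from continuous_AE_eq_at_0[OF T c'(1) c this] c'(3) show "v = c 0" by simp
qed

lemma primitive_0:
  assumes "f \<in> L2_on {0..T}"
  shows "primitive (rep_L2 f) 0 = 0"
  unfolding primitive_def
proof (rule integral_eq_zero_AE)
  show "AE s in lborel. indicator {..0} s *\<^sub>R rep_L2 f s = 0"
    using rep_L2_on_Icc[OF assms] by eventually_elim (auto simp: indicator_def)
qed

lemma initial_value_eq_trace0:
  assumes T: "T > 0" and f: "(f, f') \<in> H1_time T V"
  shows "initial_value T f = trace0 T (f, f')"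
proof -
  have f: "f \<in> L2_on {0..T}" "f' \<in> L2_on {0..T}" "weak_partial {0<..<T} 1 (rep_L2 f) (rep_L2 f')"
    using f by (auto simp: H1_time_def L2_time_def)
  have "initial_value T f = trace0 T (f, f') + primitive (rep_L2 f') 0"
    using trace0_representation[OF T f]
    by (intro initial_value_eqI T continuous_intros continuous_on_primitive integrable_rep_L2_on[OF f(2)])
  then show ?thesis by (simp add: primitive_0[OF f(2)])
qed

section \<open>Functions of time with values in an integral-closed subspace\<close>

lemma AE_rep_L2_time:
  assumes "f \<in> L2_time T V" "0 \<in> V"
  shows "AE t in lborel. rep_L2 f t \<in> V"
proof -
  have "AE t in lborel. t \<notin> {0..T} \<longrightarrow> rep_L2 f t = 0"
    "AE t in lborel. t \<in> {0..T} \<longrightarrow> rep_L2 f t \<in> V"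
    using assms by (auto simp: L2_time_def L2_on_def)
  then show ?thesis by eventually_elim (use assms in auto)
qed

lemma integral_in_time_valued:
  assumes V: "integral_closed V" and f: "f \<in> L2_time T V" and k: "square_integrable k"
  shows "(LINT t|lborel. k t *\<^sub>R rep_L2 f t) \<in> V"
proof (rule integral_closedD(2)[OF V integrable_pairing(1)[OF k square_integrable_rep]])
  show "AE t in lborel. k t *\<^sub>R rep_L2 f t \<in> V"
    using AE_rep_L2_time[OF f subspace_0[OF integral_closedD(1)[OF V]]]
    by eventually_elim (intro subspace_scale integral_closedD(1)[OF V])
qed

text \<open>\<open>trace0\<close> is a linear combination of two weighted integrals of functions
  with values in \<open>V\<close>.\<close>

lemma trace0_in:
  assumes V: "integral_closed V" and f: "(f, f') \<in> H1_time T V"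
  shows "trace0 T (f, f') \<in> V"
  using f unfolding trace0_def H1_time_def
  by (auto intro!: subspace_scale subspace_diff integral_closedD(1)[OF V] integral_in_time_valued[OF V]
      square_integrable_Ioo square_integrable_linear_weight)

lemma L2_time_uminus:
  assumes V: "subspace V" and f: "f \<in> L2_time T V"
  shows "- f \<in> L2_time T V"
proof -
  have "AE t in lborel. t \<notin> {0..T} \<longrightarrow> rep_L2 f t = 0"
    "AE t in lborel. t \<in> {0..T} \<longrightarrow> rep_L2 f t \<in> V"
    using f by (auto simp: L2_time_def L2_on_def)
  then have "AE t in lborel. (t \<notin> {0..T} \<longrightarrow> rep_L2 (- f) t = 0) \<and> (t \<in> {0..T} \<longrightarrow> rep_L2 (- f) t \<in> V)"
    using rep_L2_uminus[of f] by eventually_elim (auto intro: subspace_neg[OF V])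
  then show ?thesis by (simp add: L2_time_def L2_on_def AE_conj_iff)
qed

lemma zero_in_L2_time: "0 \<in> V \<Longrightarrow> 0 \<in> L2_time T V"
  using rep_L2_zero by (auto simp: L2_time_def L2_on_def elim: eventually_mono)

text \<open>The witness for surjectivity is \<open>a\<close> plus the primitive of \<open>z\<close>,
  cut off outside \<open>[0, T]\<close>. Test functions live in the open interval and do not see the
  jumps of the cutoff at its ends.\<close>

lemma H1_time_primitive:
  fixes V :: "'v::{banach, second_countable_topology} set"
  assumes T: "T > 0" and V: "integral_closed V" and a: "a \<in> V" and z: "z \<in> L2_time T V"
  obtains f where "(f, z) \<in> H1_time T V" "initial_value T f = a"
proof -
  have zon: "z \<in> L2_on {0..T}" using z by (simp add: L2_time_def)
  note zint = integrable_rep_L2_on[OF zon]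
  define J where "J = primitive (rep_L2 z)"
  have J: "continuous_on A (\<lambda>t. a + J t)" for A
    unfolding J_def by (intro continuous_intros continuous_on_primitive zint)
  have Jm: "(\<lambda>t. a + J t) \<in> borel_measurable borel"
    by (rule borel_measurable_continuous_onI[OF J])
  have sq: "square_integrable (\<lambda>t. indicator {0..T} t *\<^sub>R (a + J t))"
  proof (rule square_integrable_dominated)
    show "integrable lborel (\<lambda>t. indicator {0..T} t *\<^sub>R (norm (a + J t))\<^sup>2)"
      by (intro borel_integrable_compact continuous_intros J) auto
    show "(\<lambda>t. indicator {0..T} t *\<^sub>R (a + J t)) \<in> borel_measurable lborel"
      using Jm by measurable
  qed (auto split: split_indicator)
  define f where "f = abs_L2 (\<lambda>t. indicator {0..T} t *\<^sub>R (a + J t))"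
  have f: "AE t in lborel. rep_L2 f t = indicator {0..T} t *\<^sub>R (a + J t)"
    unfolding f_def by (rule rep_abs_L2[OF sq])
  \<comment> \<open>Holds for every \<open>t\<close>, not just almost every one: each value is
    \<open>a\<close> plus a Bochner integral of a function with values in \<open>V\<close>.\<close>
  have JV: "a + J t \<in> V" for t
  proof -
    have "AE s in lborel. indicator {..t} s *\<^sub>R rep_L2 z s \<in> V"
      using AE_rep_L2_time[OF z subspace_0[OF integral_closedD(1)[OF V]]]
      by eventually_elim (intro subspace_scale integral_closedD(1)[OF V])
    then have "J t \<in> V"
      unfolding J_def primitive_def
      using zint integrable_mult_indicator[of "{..t}" lborel "rep_L2 z"]
      by (intro integral_closedD(2)[OF V]) auto
    then show ?thesis using a by (intro subspace_add integral_closedD(1)[OF V])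
  qed
  have fV: "f \<in> L2_time T V"
    using f JV by (auto simp: L2_time_def L2_on_def elim!: eventually_mono)
  have "weak_partial {0<..<T} 1 (rep_L2 f) (rep_L2 z)"
    unfolding weak_partial_def
  proof
    fix \<eta> :: "real \<Rightarrow> real" assume \<eta>: "\<eta> \<in> test_functions {0<..<T}"
    let ?d = "\<lambda>t. frechet_derivative \<eta> (at t) 1"
    note parts = test_function_by_parts[OF \<eta> zint, folded J_def]
    have d0: "?d t = 0" if "t \<notin> {0<..<T}" for t
      using frechet_derivative_support[of \<eta> t 1] test_functionsD(2)[OF \<eta>] that by blast
    have \<eta>0: "\<eta> t = 0" if "t \<notin> {0<..<T}" for t
      using test_functionsD(2)[OF \<eta>] closure_subset[of "{x. \<eta> x \<noteq> 0}"] that by blast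
    have dint: "integrable lborel ?d" by (rule test_functionsD(7)[OF \<eta>])
    have [measurable]: "?d \<in> borel_measurable borel" using dint by auto
    note [measurable] = Jm
    \<comment> \<open>This removes the constant \<open>a\<close>: the derivative of a test function
      integrates to 0.\<close>
    have mean: "(LINT t|lborel. ?d t) = 0"
    proof -
      have "?d t = ?d t * indicator {0..T} t" for t
        using d0[of t] by (cases "t \<in> {0<..<T}") auto
      then have "(LINT t|lborel. ?d t) = (LINT t|lborel. ?d t * indicator {0..T} t)"
        by (rule Bochner_Integration.integral_cong[OF refl])
      also have "\<dots> = \<eta> T - \<eta> 0"
      proof (rule integral_FTC_Icc_real)
        show "isCont ?d t" for t
          using test_functionsD(4)[OF \<eta>, of 1] by (simp add: continuous_on_eq_continuous_at)
      qed (use T in \<open>auto intro: has_real_derivative_frechet test_functionsD(3)[OF \<eta>]\<close>)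
      finally show ?thesis by (simp add: \<eta>0)
    qed
    have "(LINT t|lborel. ?d t *\<^sub>R rep_L2 f t) = (LINT t|lborel. ?d t *\<^sub>R a + ?d t *\<^sub>R J t)"
    proof (rule integral_cong_AE)
      show "AE t in lborel. ?d t *\<^sub>R rep_L2 f t = ?d t *\<^sub>R a + ?d t *\<^sub>R J t"
        using f
      proof eventually_elim
        case (elim t)
        then show ?case using d0[of t] by (cases "t \<in> {0<..<T}") (auto simp: scaleR_add_right)
      qed
      show "(\<lambda>t. ?d t *\<^sub>R a + ?d t *\<^sub>R J t) \<in> borel_measurable lborel"
        unfolding scaleR_add_right[symmetric] by measurable
    qed measurable
    also have "\<dots> = (LINT t|lborel. ?d t) *\<^sub>R a + (LINT t|lborel. ?d t *\<^sub>R J t)"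
      using dint parts(1) by simp
    also have "\<dots> = - (LINT t|lborel. \<eta> t *\<^sub>R rep_L2 z t)"
      by (simp add: mean parts(2))
    finally show "(LINT t|lborel. ?d t *\<^sub>R rep_L2 f t) = - (LINT t|lborel. \<eta> t *\<^sub>R rep_L2 z t)" .
  qed
  with fV z have "(f, z) \<in> H1_time T V" by (simp add: H1_time_def)
  moreover have "initial_value T f = a + J 0"
    using f by (intro initial_value_eqI T J) (auto elim!: eventually_mono)
  then have "initial_value T f = a" by (simp add: J_def primitive_0[OF zon])
  ultimately show ?thesis by (rule that)
qed

text \<open>Supplies the displacement component of the preimage. The constant sequence of zero
  functions witnesses its trace.\<close>

lemma zero_in_V_u:
  assumes "\<Omega> \<in> sets borel"
  shows "0 \<in> V_u \<Omega> \<Gamma>\<^sub>D"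
proof -
  have "has_trace \<Omega> (0 :: h1_vector) (\<lambda>x. 0)"
    unfolding has_trace_def
  proof (intro conjI exI[of _ "\<lambda>k x. 0"] allI)
    have "gradient (\<lambda>x. 0 :: real^2) = (\<lambda>x. 0)"
      by (simp add: gradient_def frechet_derivative_const fun_eq_iff vec_eq_iff)
    moreover have "restrict_L2 \<Omega> (\<lambda>x. 0 :: 'b::{banach, second_countable_topology}) = 0"
      by (simp add: restrict_L2_def zero_L2_def map_fun_def)
    ultimately show "(\<lambda>k. (restrict_L2 \<Omega> (\<lambda>x. 0 :: real^2), restrict_L2 \<Omega> (gradient (\<lambda>x. 0 :: real^2)))) \<longlonglongrightarrow> 0"
      by (simp add: zero_prod_def restrict_L2_def zero_L2_def map_fun_def)
  qed (auto simp: C_infinity_def C_k_zero)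
  then show ?thesis
    using subspace_0[OF integral_closedD(1)[OF integral_closed_sobolev_H1[OF assms]]]
    by (auto simp: V_u_def)
qed

section \<open>The derivative of the constraint map and its range\<close>

theorem lemma3p3:
  fixes \<Omega> \<Gamma>\<^sub>N \<Gamma>\<^sub>D \<Gamma>\<^sub>F :: "(real^2) set" and T :: real and \<phi>\<^sub>0 :: h2_scalar
  assumes "bounded \<Omega>" and "lipschitz_domain \<Omega>"
    and "frontier \<Omega> = \<Gamma>\<^sub>N \<union> \<Gamma>\<^sub>D \<union> \<Gamma>\<^sub>F"
    and "\<Gamma>\<^sub>N \<inter> \<Gamma>\<^sub>D = {}" and "\<Gamma>\<^sub>N \<inter> \<Gamma>\<^sub>F = {}" and "\<Gamma>\<^sub>D \<inter> \<Gamma>\<^sub>F = {}"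
    and "hausdorff1 \<Gamma>\<^sub>D \<noteq> 0" and "hausdorff1 \<Gamma>\<^sub>N \<noteq> 0"
    and "groeger_regular (\<Omega> \<union> \<Gamma>\<^sub>N)"
    and "T > 0"
    and "\<phi>\<^sub>0 \<in> V_phi \<Omega>"
  shows "constraint_map T \<phi>\<^sub>0 ` space_Y \<Omega> \<Gamma>\<^sub>D T \<subseteq> space_Z \<Omega> T \<and>
    (\<forall>y \<in> feasible_set \<Omega> \<Gamma>\<^sub>D T \<phi>\<^sub>0.
      \<exists>g'. (constraint_map T \<phi>\<^sub>0 has_derivative g') (at y within space_Y \<Omega> \<Gamma>\<^sub>D T) \<and>
        (\<forall>(\<Phi>\<^sub>u, \<Phi>, \<Phi>') \<in> space_Y \<Omega> \<Gamma>\<^sub>D T. g' (\<Phi>\<^sub>u, \<Phi>, \<Phi>') = (initial_value T \<Phi>, - \<Phi>')) \<and>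
        g' ` space_Y \<Omega> \<Gamma>\<^sub>D T = space_Z \<Omega> T)"
proof -
  have \<Omega>: "\<Omega> \<in> sets borel" using assms(2) by (auto simp: lipschitz_domain_def)
  note V = integral_closed_sobolev_H2[OF \<Omega>]
  note sV = integral_closedD(1)[OF V]
  define g' :: "state \<Rightarrow> h2_scalar \<times> (real, h2_scalar) L2" where
    "g' y = (trace0 T (snd y), - snd (snd y))" for y
  have g': "bounded_linear g'"
    unfolding g'_def[abs_def]
    by (intro bounded_linear_Pair bounded_linear_minus bounded_linear_compose[OF bounded_linear_trace0]
        bounded_linear_snd bounded_linear_compose[OF bounded_linear_snd bounded_linear_snd])
  have iv: "initial_value T \<Phi> = trace0 T (\<Phi>, \<Phi>')" "initial_value T \<Phi> \<in> V_phi \<Omega>" "- \<Phi>' \<in> L2_time T (V_phi \<Omega>)"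
    if "(\<Phi>\<^sub>u, \<Phi>, \<Phi>') \<in> space_Y \<Omega> \<Gamma>\<^sub>D T" for \<Phi>\<^sub>u \<Phi> \<Phi>'
  proof -
    have H: "(\<Phi>, \<Phi>') \<in> H1_time T (V_phi \<Omega>)" using that by (simp add: space_Y_def)
    show *: "initial_value T \<Phi> = trace0 T (\<Phi>, \<Phi>')"
      by (rule initial_value_eq_trace0[OF \<open>T > 0\<close> H])
    show "initial_value T \<Phi> \<in> V_phi \<Omega>" unfolding * by (rule trace0_in[OF V H])
    show "- \<Phi>' \<in> L2_time T (V_phi \<Omega>)"
      using H by (intro L2_time_uminus sV) (simp add: H1_time_def)
  qed
  have g'_eq: "g' (\<Phi>\<^sub>u, \<Phi>, \<Phi>') = (initial_value T \<Phi>, - \<Phi>')"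
    if "(\<Phi>\<^sub>u, \<Phi>, \<Phi>') \<in> space_Y \<Omega> \<Gamma>\<^sub>D T" for \<Phi>\<^sub>u \<Phi> \<Phi>'
    using iv(1)[OF that] by (simp add: g'_def)
  have "constraint_map T \<phi>\<^sub>0 ` space_Y \<Omega> \<Gamma>\<^sub>D T \<subseteq> space_Z \<Omega> T"
    using iv(2,3) assms(11)
    by (auto simp: constraint_map_def space_Z_def intro!: subspace_diff[OF sV])
  moreover have "(constraint_map T \<phi>\<^sub>0 has_derivative g') (at y within space_Y \<Omega> \<Gamma>\<^sub>D T)"
    if "y \<in> feasible_set \<Omega> \<Gamma>\<^sub>D T \<phi>\<^sub>0" for y
  proof (rule has_derivative_transform)
    show "y \<in> space_Y \<Omega> \<Gamma>\<^sub>D T" using that by (simp add: feasible_set_def)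
    \<comment> \<open>The affine formula is available only on \<open>space_Y\<close>, where
      \<open>trace0\<close> and \<open>initial_value\<close> agree; therefore the derivative is
      taken within this set.\<close>
    show "constraint_map T \<phi>\<^sub>0 x = g' x - (\<phi>\<^sub>0, 0)" if "x \<in> space_Y \<Omega> \<Gamma>\<^sub>D T" for x
      using g'_eq[of "fst x" "fst (snd x)" "snd (snd x)"] that
      by (simp add: constraint_map_def case_prod_beta)
    show "((\<lambda>x. g' x - (\<phi>\<^sub>0, 0)) has_derivative g') (at y within space_Y \<Omega> \<Gamma>\<^sub>D T)"
      using has_derivative_diff[OF bounded_linear_imp_has_derivative[OF g'] has_derivative_const]
      by simp
  qed
  moreover have "g' ` space_Y \<Omega> \<Gamma>\<^sub>D T = space_Z \<Omega> T"
  proof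
    show "g' ` space_Y \<Omega> \<Gamma>\<^sub>D T \<subseteq> space_Z \<Omega> T"
      using iv(2,3) g'_eq by (auto simp: space_Z_def)
    show "space_Z \<Omega> T \<subseteq> g' ` space_Y \<Omega> \<Gamma>\<^sub>D T"
    proof
      fix w assume "w \<in> space_Z \<Omega> T"
      then obtain a z where w: "w = (a, z)" "a \<in> V_phi \<Omega>" "z \<in> L2_time T (V_phi \<Omega>)"
        by (auto simp: space_Z_def)
      \<comment> \<open>The time derivative is chosen as \<open>- z\<close> since the second
        component of \<open>g'\<close> reverses the sign.\<close>
      obtain f where f: "(f, - z) \<in> H1_time T (V_phi \<Omega>)" "initial_value T f = a"
        using H1_time_primitive[OF \<open>T > 0\<close> V w(2) L2_time_uminus[OF sV w(3)]] .
      have "(0, f, - z) \<in> space_Y \<Omega> \<Gamma>\<^sub>D T"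
        using f(1) by (simp add: space_Y_def zero_in_L2_time zero_in_V_u[OF \<Omega>])
      from imageI[OF this, of g'] g'_eq[OF this] show "w \<in> g' ` space_Y \<Omega> \<Gamma>\<^sub>D T"
        by (simp add: w(1) f(2))
    qed
  qed
  ultimately show ?thesis using g'_eq by blast
qed

end
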